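(* Let $a\in L^1(I)$. For every $\lambda<\lambda_0^{M_1}$ and all $(t,s)\in(0,1)\times(0,1)$, $$G_{M_1}[\lambda](t,s)<G_D[\lambda](t,s)<0.$$
   Context: $I=[0,1]$, $a\in L^1(I)$ is real-valued, $\lambda\in\mathbb{R}$, and $L[\lambda]u(t)=u''(t)+(a(t)+\lambda)u(t)$. $W^{2,1}(I)=\{u\in C(I):u'\in AC(I)\}$, where $AC(I)$ is the set of absolutely continuous functions on $I$. $X_D=\{u\in W^{2,1}(I):u(0)=u(1)=0\}$ (Dirichlet) and $X_{M_1}=\{u\in W^{2,1}(I):u'(0)=u(1)=0\}$ (Mixed 1). $L[\lambda]$ is nonresonant in $X$ if $u=0$ is the only $u\in X$ with $L[\lambda]u=0$ a.e. on $I$. In that case, for every $\sigma\in L^1(I)$ the problem $L[\lambda]u=\sigma$ a.e. on $I$, $u\in X$, has a unique solution, given by $u(t)=\int_0^1G(t,s)\sigma(s)\,ds$, where the continuous function $G:I\times I\to\mathbb{R}$ is the Green's function; it is denoted $G_D[\lambda]$ for $X=X_D$ and $G_{M_1}[\lambda]$ for $X=X_{M_1}$. $\lambda_0^{M_1}$ and $\lambda_0^D$ denote the first (smallest) eigenvalues of the Mixed 1 and Dirichlet problems, i.e. the smallest $\lambda$ for which $L[\lambda]u=0$ a.e. has a nontrivial solution in $X_{M_1}$, respectively $X_D$. It is known that $\lambda_0^{M_1}<\lambda_0^D$, so both Green's functions exist for $\lambda<\lambda_0^{M_1}$. *)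

theory Defs
  imports "HOL-Analysis.Analysis"
begin

text \<open>
  Functions on the interval \<open>I\<close> are represented by functions of type \<open>real \<Rightarrow> real\<close>; none of the
  notions below depends on their values outside \<open>I\<close>.
\<close>

abbreviation I :: "real set" where
  "I \<equiv> {0..1}"

definition abs_continuous_on :: "real set \<Rightarrow> (real \<Rightarrow> real) \<Rightarrow> bool" where
  "abs_continuous_on S f \<longleftrightarrow>
     (\<forall>\<epsilon>>0. \<exists>\<delta>>0. \<forall>(n::nat) \<alpha> \<beta>.
        (\<forall>i<n. \<alpha> i < \<beta> i \<and> {\<alpha> i..\<beta> i} \<subseteq> S) \<longrightarrow>
        disjoint_family_on (\<lambda>i. {\<alpha> i<..<\<beta> i}) {..<n} \<longrightarrow>
        (\<Sum>i<n. \<beta> i - \<alpha> i) < \<delta> \<longrightarrow>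
        (\<Sum>i<n. \<bar>f (\<beta> i) - f (\<alpha> i)\<bar>) < \<epsilon>)"

text \<open>The derivative relative to \<open>I\<close>, hence one-sided at the two end points.\<close>

definition DI :: "(real \<Rightarrow> real) \<Rightarrow> real \<Rightarrow> real" where
  "DI u t = vector_derivative u (at t within I)"

definition W21 :: "(real \<Rightarrow> real) set" where
  "W21 = {u. u differentiable_on I \<and> abs_continuous_on I (DI u)}"

definition X_D :: "(real \<Rightarrow> real) set" where
  "X_D = {u \<in> W21. u 0 = 0 \<and> u 1 = 0}"

definition X_M1 :: "(real \<Rightarrow> real) set" where
  "X_M1 = {u \<in> W21. DI u 0 = 0 \<and> u 1 = 0}"

text \<open>
  For \<open>u \<in> W21\<close> the derivative \<open>DI u\<close> is differentiable almost everywhere on \<open>I\<close>. Where it is not,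
  \<open>DI (DI u)\<close> has an arbitrary value, so \<open>Lop\<close> is only ever used in almost-everywhere statements.
\<close>

definition Lop :: "(real \<Rightarrow> real) \<Rightarrow> real \<Rightarrow> (real \<Rightarrow> real) \<Rightarrow> real \<Rightarrow> real" where
  "Lop a l u t = DI (DI u) t + (a t + l) * u t"

definition solves :: "(real \<Rightarrow> real) \<Rightarrow> real \<Rightarrow> (real \<Rightarrow> real) \<Rightarrow> (real \<Rightarrow> real) \<Rightarrow> bool" where
  "solves a l \<sigma> u \<longleftrightarrow> (AE t\<in>I in lebesgue. Lop a l u t = \<sigma> t)"

definition nonresonant :: "(real \<Rightarrow> real) set \<Rightarrow> (real \<Rightarrow> real) \<Rightarrow> real \<Rightarrow> bool" where
  "nonresonant X a l \<longleftrightarrow>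
     (\<forall>u\<in>X. solves a l (\<lambda>_. 0) u \<longrightarrow> (\<forall>t\<in>I. u t = 0))"

definition is_eigenvalue :: "(real \<Rightarrow> real) set \<Rightarrow> (real \<Rightarrow> real) \<Rightarrow> real \<Rightarrow> bool" where
  "is_eigenvalue X a l \<longleftrightarrow>
     (\<exists>u\<in>X. solves a l (\<lambda>_. 0) u \<and> (\<exists>t\<in>I. u t \<noteq> 0))"

definition is_first_eigenvalue :: "(real \<Rightarrow> real) set \<Rightarrow> (real \<Rightarrow> real) \<Rightarrow> real \<Rightarrow> bool" where
  "is_first_eigenvalue X a l0 \<longleftrightarrow>
     is_eigenvalue X a l0 \<and> (\<forall>\<mu>. is_eigenvalue X a \<mu> \<longrightarrow> l0 \<le> \<mu>)"

text \<open>
  Uniqueness of the solution that the kernel \<open>G\<close> produces is the first conjunct.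
\<close>

definition is_green ::
    "(real \<Rightarrow> real) set \<Rightarrow> (real \<Rightarrow> real) \<Rightarrow> real \<Rightarrow> (real \<Rightarrow> real \<Rightarrow> real) \<Rightarrow> bool" where
  "is_green X a l G \<longleftrightarrow>
     nonresonant X a l \<and>
     continuous_on (I \<times> I) (\<lambda>(t, s). G t s) \<and>
     (\<forall>\<sigma>. \<sigma> absolutely_integrable_on I \<longrightarrow>
        (\<lambda>t. LINT s:I|lebesgue. G t s * \<sigma> s) \<in> X \<and>
        solves a l \<sigma> (\<lambda>t. LINT s:I|lebesgue. G t s * \<sigma> s))"

text \<open>
  Any two kernels satisfying \<^const>\<open>is_green\<close> agree on \<open>I \<times> I\<close> by continuity, so the choice
  below only affects values outside the square.
\<close>

definition green ::
    "(real \<Rightarrow> real) set \<Rightarrow> (real \<Rightarrow> real) \<Rightarrow> real \<Rightarrow> real \<Rightarrow> real \<Rightarrow> real" where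
  "green X a l = (SOME G. is_green X a l G)"

end

theory Submission
  imports Defs
begin

text \<open>
  Put \<open>A(t) = \<integral>\<^sub>0\<^sup>t a\<close> and attach to \<open>u\<close> the quasi-derivative \<open>z = u' + A u\<close>. The equation
  \<open>u'' + (a + l) u = \<sigma>\<close> turns into
  \<open>u' = z - A u\<close>, \<open>z' = A z - (A\<^sup>2 + l) u + \<sigma>\<close>,
  whose coefficients are continuous although \<open>a\<close> is only integrable. So for \<open>\<sigma> = 0\<close> all solutions are
  classical, and because the coefficient matrix has trace zero the Wronskian \<open>u w - v z\<close> of two
  solutions is constant. Since \<open>A 0 = 0\<close>, the data of \<open>(u, z)\<close> at \<open>0\<close> are \<open>(u(0), u'(0))\<close>.

  Let \<open>\<phi>\<close> and \<open>\<theta>\<close> be the solutions with data \<open>(1, 0)\<close> and \<open>(0, 1)\<close> at \<open>0\<close>, and let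
  \<open>\<psi> = \<theta>(1) \<phi> - \<phi>(1) \<theta>\<close>, which vanishes at \<open>1\<close>. With \<open>m = min t s\<close> and \<open>M = max t s\<close>, variation of
  constants (\<open>green_kernel\<close>) gives
  \<open>G\<^sub>M\<^sub>1(t,s) = - \<phi>(m) \<psi>(M) / \<phi>(1)\<close> and \<open>G\<^sub>D(t,s) = - \<theta>(m) \<psi>(M) / \<theta>(1)\<close>,
  and subtracting,
  \<open>G\<^sub>M\<^sub>1(t,s) - G\<^sub>D(t,s) = - \<psi>(m) \<psi>(M) / (\<phi>(1) \<theta>(1))\<close>.
  It remains to see that \<open>\<theta>\<close> is positive on \<open>(0,1]\<close> and \<open>\<psi>\<close> on \<open>[0,1)\<close>. Both follow from \<open>\<phi> > 0\<close> on \<open>I\<close>: then \<open>\<theta> / \<phi>\<close> has derivative \<open>1 / \<phi>\<^sup>2\<close>, so it increases from \<open>0\<close>, and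
  \<open>\<psi> = \<phi> \<phi>(1) (\<theta>(1)/\<phi>(1) - \<theta>/\<phi>)\<close>.

  That \<open>\<phi>\<close> is positive for \<open>l\<close> below the first mixed eigenvalue (\<open>system_positive\<close>) is a continuation
  argument in \<open>l\<close>. For very negative \<open>l\<close> the system is cooperative and \<open>\<phi> > 0\<close>. At the smallest
  parameter at which positivity fails, \<open>\<phi>\<close> is nonnegative with a zero; a zero inside the interval
  would be a double zero, so the zero is at \<open>1\<close>, and the parameter is an eigenvalue.

  The link between the almost-everywhere equation and the system rests on the theory of absolutely
  continuous functions: such a function is an indefinite integral (\<open>abs_continuous_on_imp_integral\<close>,
  by Jordan decomposition and Radon--Nikodym), and an indefinite integral has the integrand as its
  derivative almost everywhere (\<open>indefinite_integral_has_derivative_ae\<close>, by Henstock's lemma and Vitali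
  covering). Only with the first fact does the equation for \<open>DI (DI u)\<close> say anything about \<open>u\<close>,
  because it supplies the differentiability of \<open>DI u\<close> almost everywhere.
\<close>

section \<open>Differentiating an indefinite integral\<close>

lemma integral_diff_eq:
  fixes g :: "real \<Rightarrow> real"
  assumes "g integrable_on {a..b}" "a \<le> x" "x \<le> y" "y \<le> b"
  shows "integral {a..y} g - integral {a..x} g = integral {x..y} g"
proof -
  have "g integrable_on {a..y}"
    by (rule integrable_on_subinterval[OF assms(1)]) (use assms in auto)
  from Henstock_Kurzweil_Integration.integral_combine[OF assms(2,3) this] show ?thesis by simp
qed

text \<open>
  Lebesgue's differentiation theorem on the line. Where the difference quotient at \<open>t\<close> misses
  \<open>g t\<close> by more than \<open>1 / (k + 1)\<close> on arbitrarily short intervals ending at \<open>t\<close>, these intervals form a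
  Vitali cover. A disjoint subfamily with tags \<open>t\<close> is a fine partial division, so Henstock's lemma
  bounds its total length by \<open>k + 1\<close> times an arbitrarily small number, and the exceptional set is null.
\<close>

theorem indefinite_integral_has_derivative_ae:
  fixes g :: "real \<Rightarrow> real"
  assumes g: "g integrable_on {a..b}"
  obtains N where "negligible N"
    "\<And>t. t \<in> {a..b} - N \<Longrightarrow>
       ((\<lambda>x. integral {a..x} g) has_real_derivative g t) (at t within {a..b})"
proof -
  define G where "G x = integral {a..x} g" for x
  have G_diff: "G y - G x = integral {x..y} g" if "a \<le> x" "x \<le> y" "y \<le> b" for x y
    unfolding G_def by (rule integral_diff_eq[OF g that])
  define bad where "bad k t y \<longleftrightarrow> y \<in> {a..b} \<and> y \<noteq> t \<and> \<bar>y - t\<bar> < real (Suc k) * \<bar>G y - G t - g t * (y - t)\<bar>"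
    for k t y
  define E where "E k = {t \<in> {a..b}. \<forall>d>0. \<exists>y. \<bar>y - t\<bar> < d \<and> bad k t y}" for k
  have neg: "negligible (E k)" for k
  proof (rule negligible_outer_le[THEN iffD2], intro allI impI)
    fix e :: real assume "e > 0"
    define e' where "e' = e / real (Suc k)"
    have "e' > 0" using \<open>e > 0\<close> by (simp add: e'_def)
    obtain \<gamma> where \<gamma>: "gauge \<gamma>"
      and fine: "\<And>p. \<lbrakk>p tagged_partial_division_of (cbox a b); \<gamma> fine p\<rbrakk> \<Longrightarrow>
             (\<Sum>(x,k)\<in>p. norm(measure lborel k *\<^sub>R g x - integral k g)) < e'"
      by (rule Henstock_lemma[of g a b e']) (use g \<open>e' > 0\<close> in \<open>simp_all add: cbox_interval\<close>)
    \<comment> \<open>A pair \<open>(t, y)\<close> encodes the interval with end points \<open>t\<close> and \<open>y\<close>, tagged by \<open>t\<close>; the covering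
      theorem is about balls, hence the centre \<open>ce\<close> and the radius \<open>ra\<close>.\<close>
    define J :: "real \<times> real \<Rightarrow> real set" where "J = (\<lambda>(t,y). {min t y..max t y})"
    define K where "K = {(t,y). t \<in> E k \<and> bad k t y \<and> J (t,y) \<subseteq> \<gamma> t}"
    define ce :: "real \<times> real \<Rightarrow> real" where "ce = (\<lambda>(t,y). (t + y)/2)"
    define ra :: "real \<times> real \<Rightarrow> real" where "ra = (\<lambda>(t,y). \<bar>y - t\<bar>/2)"
    have J: "cball (ce i) (ra i) = J i" for i
      by (cases i) (auto simp: J_def ce_def ra_def cball_eq_atLeastAtMost min_def max_def field_simps abs_if)
    have r: "0 < ra i" if "i \<in> K" for i
      using that by (auto simp: K_def ra_def bad_def)
    have fineK: "\<exists>i. i \<in> K \<and> x \<in> cball (ce i) (ra i) \<and> ra i < d" if xE: "x \<in> E k" and "0 < d" for x d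
    proof -
      obtain \<rho> where \<rho>: "\<rho> > 0" "ball x \<rho> \<subseteq> \<gamma> x"
        using \<gamma> unfolding gauge_def by (meson openE)
      have "0 < min d \<rho>" using \<open>0 < d\<close> \<open>\<rho> > 0\<close> by simp
      then obtain y where y: "\<bar>y - x\<bar> < min d \<rho>" "bad k x y"
        using xE unfolding E_def by blast
      have "J (x,y) \<subseteq> ball x \<rho>"
        using y by (auto simp: J_def dist_real_def)
      then have "(x,y) \<in> K"
        using xE y \<rho> by (auto simp: K_def)
      moreover have "x \<in> cball (ce (x,y)) (ra (x,y))"
        unfolding J by (auto simp: J_def)
      moreover have "ra (x,y) < d" using y by (auto simp: ra_def)
      ultimately show ?thesis by blast
    qed
    obtain C where C: "countable C" "C \<subseteq> K"
      and disj: "pairwise (\<lambda>i j. disjnt (J i) (J j)) C"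
      and negC: "negligible (E k - (\<Union>i\<in>C. J i))"
      by (rule Vitali_covering_theorem_cballs[of K ra "E k" ce, unfolded J, OF r fineK[unfolded J]])
    have bound: "measure lebesgue (\<Union>i\<in>F. J i) \<le> e" if F: "F \<subseteq> C" "finite F" for F
    proof -
      define p where "p = (\<lambda>i. (fst i, J i)) ` F"
      have FK: "i \<in> K" if "i \<in> F" for i using that F C by blast
      have tag: "fst i \<in> J i" for i by (cases i) (auto simp: J_def)
      have sub: "J i \<subseteq> {a..b}" if "i \<in> F" for i
        using FK[OF that] by (cases i) (auto simp: K_def J_def bad_def E_def)
      have Jbox: "J i = cbox (min (fst i) (snd i)) (max (fst i) (snd i))" for i
        by (cases i) (auto simp: J_def)
      have eq: "i = j" if "i \<in> F" "j \<in> F" "J i \<inter> J j \<noteq> {}" for i j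
        using disj that F unfolding pairwise_def disjnt_def by blast
      have inj: "inj_on (\<lambda>i. (fst i, J i)) F"
        using eq tag by (intro inj_onI) (metis disjoint_iff prod.inject)
      have "p tagged_partial_division_of (cbox a b)"
        unfolding tagged_partial_division_of_def
      proof (intro conjI allI impI)
        show "finite p" using F by (simp add: p_def)
        show "x \<in> k" if "(x,k) \<in> p" for x k using that tag by (auto simp: p_def)
        show "k \<subseteq> cbox a b" if "(x,k) \<in> p" for x k
          using that sub by (auto simp: p_def)
        show "\<exists>a b. k = cbox a b" if "(x,k) \<in> p" for x k
          using that Jbox by (auto simp: p_def)
        show "interior k1 \<inter> interior k2 = {}"
          if pp: "(x1,k1) \<in> p \<and> (x2,k2) \<in> p \<and> (x1,k1) \<noteq> (x2,k2)" for x1 k1 x2 k2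
        proof -
          obtain i where i: "i \<in> F" "(x1,k1) = (fst i, J i)"
            using pp unfolding p_def by blast
          obtain j where j: "j \<in> F" "(x2,k2) = (fst j, J j)"
            using pp unfolding p_def by blast
          from i j have "k1 \<inter> k2 = {}" using that eq[of i j] by auto
          then show ?thesis using interior_subset by blast
        qed
      qed
      moreover have "\<gamma> fine p"
        using FK by (fastforce simp: fine_def p_def K_def)
      ultimately have "(\<Sum>(x,k)\<in>p. norm(measure lborel k *\<^sub>R g x - integral k g)) < e'"
        by (rule fine)
      also have "(\<Sum>(x,k)\<in>p. norm(measure lborel k *\<^sub>R g x - integral k g))
          = (\<Sum>i\<in>F. norm (measure lborel (J i) *\<^sub>R g (fst i) - integral (J i) g))"
        unfolding p_def by (subst sum.reindex[OF inj]) simp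
      finally have less: "(\<Sum>i\<in>F. norm (measure lborel (J i) *\<^sub>R g (fst i) - integral (J i) g)) < e'" .
      have "measure lebesgue (J i) \<le> real (Suc k) * norm (measure lborel (J i) *\<^sub>R g (fst i) - integral (J i) g)"
        if "i \<in> F" for i
      proof -
        obtain t y where i: "i = (t,y)" by (cases i)
        have ty: "t \<in> {a..b}" "y \<in> {a..b}" and b: "bad k t y"
          using FK[OF that] by (auto simp: i K_def E_def bad_def)
        have "norm (measure lborel (J i) *\<^sub>R g (fst i) - integral (J i) g) = \<bar>G y - G t - g t * (y - t)\<bar>"
        proof (cases "t \<le> y")
          case True
          then show ?thesis using G_diff[of t y] ty by (simp add: i J_def algebra_simps abs_minus_commute)
        next
          case False
          then have "G t - G y = integral {y..t} g" using G_diff[of y t] ty by simp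
          then show ?thesis using False by (simp add: i J_def algebra_simps min_def max_def abs_minus_commute)
        qed
        moreover have "measure lebesgue (J i) = \<bar>y - t\<bar>"
          by (auto simp: i J_def min_def max_def)
        ultimately show ?thesis using b by (auto simp: bad_def)
      qed
      then have "(\<Sum>i\<in>F. measure lebesgue (J i)) \<le> real (Suc k) * (\<Sum>i\<in>F. norm (measure lborel (J i) *\<^sub>R g (fst i) - integral (J i) g))"
        by (simp only: sum_distrib_left) (rule sum_mono)
      also have "\<dots> \<le> real (Suc k) * e'" using less by (intro mult_left_mono) auto
      also have "\<dots> = e" by (simp add: e'_def)
      finally have "(\<Sum>i\<in>F. measure lebesgue (J i)) \<le> e" .
      moreover have "measure lebesgue (\<Union>i\<in>F. J i) \<le> (\<Sum>i\<in>F. measure lebesgue (J i))"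
        using F Jbox by (intro measure_UNION_le) auto
      ultimately show ?thesis by linarith
    qed
    have Jm: "J i \<in> lmeasurable" for i by (cases i) (auto simp: J_def)
    have UC: "(\<Union>i\<in>C. J i) \<in> lmeasurable" "measure lebesgue (\<Union>i\<in>C. J i) \<le> e"
      using fmeasurable_UN_bound[OF C(1) Jm bound] measure_UN_bound[OF C(1) Jm bound] by auto
    let ?T = "(E k - (\<Union>i\<in>C. J i)) \<union> (\<Union>i\<in>C. J i)"
    have "?T \<in> lmeasurable"
      by (intro fmeasurable.Un negligible_imp_measurable[OF negC] UC)
    moreover have "measure lebesgue ?T \<le> measure lebesgue (E k - (\<Union>i\<in>C. J i)) + measure lebesgue (\<Union>i\<in>C. J i)"
      using negC UC(1) by (intro measure_Un_le) (auto simp: negligible_imp_sets fmeasurableD)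
    then have "measure lebesgue ?T \<le> e"
      using UC(2) negligible_imp_measure0[OF negC] by linarith
    ultimately show "\<exists>T. E k \<subseteq> T \<and> T \<in> lmeasurable \<and> measure lebesgue T \<le> e"
      by (intro exI[of _ ?T]) auto
  qed
  show thesis
  proof
    show "negligible (\<Union>k. E k)" by (intro negligible_countable_Union) (auto simp: neg)
    fix t assume t: "t \<in> {a..b} - (\<Union>k. E k)"
    have "((\<lambda>y. (G y - G t) / (y - t)) \<longlongrightarrow> g t) (at t within {a..b})"
    proof (rule tendstoI)
      fix e :: real assume "e > 0"
      obtain k where k: "inverse (real (Suc k)) < e" using reals_Archimedean[OF \<open>e > 0\<close>] by blast
      obtain d where d: "d > 0" "\<And>y. \<bar>y - t\<bar> < d \<Longrightarrow> \<not> bad k t y"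
        using t unfolding E_def by blast
      have "dist ((G y - G t) / (y - t)) (g t) < e" if y: "y \<in> {a..b}" "y \<noteq> t" "dist y t < d" for y
      proof -
        have "real (Suc k) * \<bar>G y - G t - g t * (y - t)\<bar> \<le> \<bar>y - t\<bar>"
          using d(2)[of y] y by (auto simp: bad_def dist_real_def)
        then have "\<bar>G y - G t - g t * (y - t)\<bar> / \<bar>y - t\<bar> \<le> inverse (real (Suc k))"
          using y by (simp add: field_simps)
        moreover have "(G y - G t) / (y - t) - g t = (G y - G t - g t * (y - t)) / (y - t)"
          using y by (simp add: field_simps)
        ultimately show ?thesis using k by (simp add: dist_real_def)
      qed
      then show "\<forall>\<^sub>F y in at t within {a..b}. dist ((G y - G t) / (y - t)) (g t) < e"
        using d(1) by (auto simp: eventually_at)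
    qed
    then show "((\<lambda>x. integral {a..x} g) has_real_derivative g t) (at t within {a..b})"
      by (simp add: has_field_derivative_iff G_def)
  qed
qed

section \<open>Absolutely continuous functions\<close>

text \<open>
  The index set is an arbitrary finite set of an arbitrary type, and degenerate intervals are allowed,
  so that families can be cut at a point and glued without renumbering.
\<close>

definition nonoverlapping :: "real \<Rightarrow> real \<Rightarrow> 'i set \<Rightarrow> ('i \<Rightarrow> real) \<Rightarrow> ('i \<Rightarrow> real) \<Rightarrow> bool" where
  "nonoverlapping x y A \<alpha> \<beta> \<longleftrightarrow>
     finite A \<and> (\<forall>i\<in>A. x \<le> \<alpha> i \<and> \<alpha> i \<le> \<beta> i \<and> \<beta> i \<le> y) \<and>
     disjoint_family_on (\<lambda>i. {\<alpha> i<..<\<beta> i}) A"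

lemma nonoverlapping_mono:
  "nonoverlapping x y A \<alpha> \<beta> \<Longrightarrow> x' \<le> x \<Longrightarrow> y \<le> y' \<Longrightarrow> nonoverlapping x' y' A \<alpha> \<beta>"
  unfolding nonoverlapping_def by force

lemma sum_integral_nonoverlapping_le:
  assumes A: "nonoverlapping x y A \<alpha> \<beta>"
    and r: "r integrable_on {x..y}" "\<And>t. t \<in> {x..y} \<Longrightarrow> 0 \<le> (r t :: real)"
  shows "(\<Sum>i\<in>A. integral {\<alpha> i..\<beta> i} r) \<le> integral {x..y} r"
proof -
  have sub: "{\<alpha> i..\<beta> i} \<subseteq> {x..y}" if "i \<in> A" for i
    using A that unfolding nonoverlapping_def by force
  have "negligible ({\<alpha> i..\<beta> i} \<inter> {\<alpha> j..\<beta> j})" if "i \<in> A" "j \<in> A" "i \<noteq> j" for i j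
  proof (rule negligible_subset)
    show "negligible {\<alpha> i, \<beta> i, \<alpha> j, \<beta> j}" by (rule negligible_finite) simp
    have "{\<alpha> i<..<\<beta> i} \<inter> {\<alpha> j<..<\<beta> j} = {}"
      using A that unfolding nonoverlapping_def disjoint_family_on_def by blast
    then show "{\<alpha> i..\<beta> i} \<inter> {\<alpha> j..\<beta> j} \<subseteq> {\<alpha> i, \<beta> i, \<alpha> j, \<beta> j}"
      by (auto simp: set_eq_iff) (metis order_le_less)
  qed
  moreover have "r integrable_on {\<alpha> i..\<beta> i}" if "i \<in> A" for i
    using integrable_on_subinterval[OF r(1) sub[OF that]] .
  ultimately have "(r has_integral (\<Sum>i\<in>A. integral {\<alpha> i..\<beta> i} r)) (\<Union>i\<in>A. {\<alpha> i..\<beta> i})"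
    using A by (intro has_integral_UN) (auto simp: nonoverlapping_def pairwise_def intro: integrable_integral)
  moreover have "(\<Union>i\<in>A. {\<alpha> i..\<beta> i}) \<subseteq> {x..y}" using sub by blast
  ultimately show ?thesis
    using r by (intro has_integral_subset_le[where f = r and s = "\<Union>i\<in>A. {\<alpha> i..\<beta> i}" and t = "{x..y}"])
      (auto intro: integrable_integral)
qed

lemma sum_length_nonoverlapping_le:
  assumes "nonoverlapping x y A \<alpha> \<beta>" "x \<le> y"
  shows "(\<Sum>i\<in>A. \<beta> i - \<alpha> i) \<le> y - x"
proof -
  have "(\<Sum>i\<in>A. \<beta> i - \<alpha> i) = (\<Sum>i\<in>A. integral {\<alpha> i..\<beta> i} (\<lambda>_. 1))"
    using assms by (intro sum.cong) (auto simp: nonoverlapping_def)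
  also have "\<dots> \<le> integral {x..y} (\<lambda>_. 1)"
    by (rule sum_integral_nonoverlapping_le[OF assms(1)]) auto
  finally show ?thesis using assms(2) by simp
qed

text \<open>
  Transfers the \<open>\<epsilon>\<close>-\<open>\<delta>\<close> condition from families indexed by an initial segment to arbitrary ones:
  degenerate intervals contribute nothing and are dropped, the others are enumerated.
\<close>

lemma abs_continuous_onD:
  assumes f: "abs_continuous_on {a..b} f" and "\<epsilon> > 0"
  obtains \<delta> where "\<delta> > 0"
    "\<And>(A::'i set) \<alpha> \<beta>. nonoverlapping a b A \<alpha> \<beta> \<Longrightarrow> (\<Sum>i\<in>A. \<beta> i - \<alpha> i) < \<delta> \<Longrightarrow>
       (\<Sum>i\<in>A. \<bar>f (\<beta> i) - f (\<alpha> i)\<bar>) < \<epsilon>"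
proof -
  obtain \<delta> where \<delta>: "\<delta> > 0" and ac: "\<And>(n::nat) \<alpha> \<beta>. \<forall>i<n. \<alpha> i < \<beta> i \<and> {\<alpha> i..\<beta> i} \<subseteq> {a..b} \<Longrightarrow>
      disjoint_family_on (\<lambda>i. {\<alpha> i<..<\<beta> i}) {..<n} \<Longrightarrow> (\<Sum>i<n. \<beta> i - \<alpha> i) < \<delta> \<Longrightarrow>
      (\<Sum>i<n. \<bar>f (\<beta> i) - f (\<alpha> i)\<bar>) < \<epsilon>"
    using f \<open>\<epsilon> > 0\<close> unfolding abs_continuous_on_def by blast
  have "(\<Sum>i\<in>A. \<bar>f (\<beta> i) - f (\<alpha> i)\<bar>) < \<epsilon>"
    if A: "nonoverlapping a b A \<alpha> \<beta>" and small: "(\<Sum>i\<in>A. \<beta> i - \<alpha> i) < \<delta>" for A :: "'i set" and \<alpha> \<beta>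
  proof -
    define B where "B = {i \<in> A. \<alpha> i < \<beta> i}"
    have fin: "finite A" "finite B" using A by (auto simp: nonoverlapping_def B_def)
    then obtain h where h: "bij_betw h {..<card B} B"
      using bij_betw_from_nat_into_finite by blast
    have eq: "(\<Sum>i\<in>A. F i) = (\<Sum>k<card B. F (h k))"
      if "\<And>i. i \<in> A \<Longrightarrow> \<alpha> i = \<beta> i \<Longrightarrow> F i = 0" for F :: "'i \<Rightarrow> real"
    proof -
      have "(\<Sum>i\<in>A. F i) = (\<Sum>i\<in>B. F i)"
        using A that fin by (intro sum.mono_neutral_right) (force simp: B_def nonoverlapping_def order_le_less)+
      also have "\<dots> = (\<Sum>k<card B. F (h k))" using sum.reindex_bij_betw[OF h, of F] by simp
      finally show ?thesis .
    qed
    have hB: "h k \<in> B" if "k < card B" for k using h that by (auto simp: bij_betw_def)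
    have "(\<Sum>k<card B. \<bar>f (\<beta> (h k)) - f (\<alpha> (h k))\<bar>) < \<epsilon>"
    proof (rule ac)
      show "\<forall>k<card B. \<alpha> (h k) < \<beta> (h k) \<and> {\<alpha> (h k)..\<beta> (h k)} \<subseteq> {a..b}"
        using hB A by (force simp: B_def nonoverlapping_def)
      have "h k \<noteq> h l" if "k < card B" "l < card B" "k \<noteq> l" for k l
        using h that by (auto simp: bij_betw_def inj_on_def)
      then show "disjoint_family_on (\<lambda>k. {\<alpha> (h k)<..<\<beta> (h k)}) {..<card B}"
        using A hB unfolding nonoverlapping_def disjoint_family_on_def B_def by blast
      show "(\<Sum>k<card B. \<beta> (h k) - \<alpha> (h k)) < \<delta>"
        using small eq[of "\<lambda>i. \<beta> i - \<alpha> i"] by simp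
    qed
    then show ?thesis using eq[of "\<lambda>i. \<bar>f (\<beta> i) - f (\<alpha> i)\<bar>"] by simp
  qed
  with \<delta> show thesis by (rule that)
qed

lemma abs_continuous_onI:
  assumes "\<And>\<epsilon>. \<epsilon> > 0 \<Longrightarrow> \<exists>\<delta>>0. \<forall>(A::nat set) \<alpha> \<beta>. nonoverlapping a b A \<alpha> \<beta> \<longrightarrow> (\<Sum>i\<in>A. \<beta> i - \<alpha> i) < \<delta> \<longrightarrow>
       (\<Sum>i\<in>A. \<bar>f (\<beta> i) - f (\<alpha> i)\<bar>) < \<epsilon>"
  shows "abs_continuous_on {a..b} f"
  unfolding abs_continuous_on_def
proof (intro allI impI)
  fix \<epsilon> :: real assume "\<epsilon> > 0"
  then obtain \<delta> where \<delta>: "\<delta> > 0" "\<And>(A::nat set) \<alpha> \<beta>. nonoverlapping a b A \<alpha> \<beta> \<Longrightarrow> (\<Sum>i\<in>A. \<beta> i - \<alpha> i) < \<delta> \<Longrightarrow>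
       (\<Sum>i\<in>A. \<bar>f (\<beta> i) - f (\<alpha> i)\<bar>) < \<epsilon>"
    using assms by blast
  have "nonoverlapping a b {..<n} \<alpha> \<beta>"
    if "\<forall>i<n. \<alpha> i < \<beta> i \<and> {\<alpha> i..\<beta> i} \<subseteq> {a..b}" "disjoint_family_on (\<lambda>i. {\<alpha> i<..<\<beta> i}) {..<n}"
    for n :: nat and \<alpha> \<beta>
    using that by (auto simp: nonoverlapping_def less_imp_le)
  with \<delta> show "\<exists>\<delta>>0. \<forall>(n::nat) \<alpha> \<beta>.
        (\<forall>i<n. \<alpha> i < \<beta> i \<and> {\<alpha> i..\<beta> i} \<subseteq> {a..b}) \<longrightarrow>
        disjoint_family_on (\<lambda>i. {\<alpha> i<..<\<beta> i}) {..<n} \<longrightarrow>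
        (\<Sum>i<n. \<beta> i - \<alpha> i) < \<delta> \<longrightarrow>
        (\<Sum>i<n. \<bar>f (\<beta> i) - f (\<alpha> i)\<bar>) < \<epsilon>"
    by blast
qed

lemma abs_continuous_on_imp_continuous_on:
  assumes "abs_continuous_on {a..b} f"
  shows "continuous_on {a..b} f"
proof (rule continuous_on_iff[THEN iffD2], intro ballI allI impI)
  fix x \<epsilon> :: real assume x: "x \<in> {a..b}" and "\<epsilon> > 0"
  obtain \<delta> where \<delta>: "\<delta> > 0"
    and ac: "\<And>(A::unit set) \<alpha> \<beta>. nonoverlapping a b A \<alpha> \<beta> \<Longrightarrow> (\<Sum>i\<in>A. \<beta> i - \<alpha> i) < \<delta> \<Longrightarrow>
       (\<Sum>i\<in>A. \<bar>f (\<beta> i) - f (\<alpha> i)\<bar>) < \<epsilon>"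
    using abs_continuous_onD[OF assms \<open>\<epsilon> > 0\<close>, where 'i = unit] by metis
  have "dist (f y) (f x) < \<epsilon>" if y: "y \<in> {a..b}" "dist y x < \<delta>" for y
  proof -
    have "(\<Sum>i\<in>{()}. \<bar>f (max x y) - f (min x y)\<bar>) < \<epsilon>"
      using x y by (intro ac[of _ "\<lambda>_. min x y" "\<lambda>_. max x y"])
        (auto simp: nonoverlapping_def disjoint_family_on_def dist_real_def)
    then show ?thesis by (auto simp: dist_real_def max_def min_def abs_minus_commute split: if_splits)
  qed
  with \<delta> show "\<exists>d>0. \<forall>x'\<in>{a..b}. dist x' x < d \<longrightarrow> dist (f x') (f x) < \<epsilon>" by blast
qed

text \<open>
  Every closure property of absolute continuity used below is an instance of this comparison.
\<close>

lemma abs_continuous_on_bound: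
  assumes f: "abs_continuous_on {a..b} f" and g: "abs_continuous_on {a..b} g"
    and C: "C > 0"
    and le: "\<And>x y. x \<in> {a..b} \<Longrightarrow> y \<in> {a..b} \<Longrightarrow> \<bar>h y - h x\<bar> \<le> C * (\<bar>f y - f x\<bar> + \<bar>g y - g x\<bar>)"
  shows "abs_continuous_on {a..b} h"
proof (rule abs_continuous_onI)
  fix \<epsilon> :: real assume "\<epsilon> > 0"
  then have e: "\<epsilon> / (2 * C) > 0" using C by simp
  obtain \<delta>1 where \<delta>1: "\<delta>1 > 0" "\<And>(A::nat set) \<alpha> \<beta>. nonoverlapping a b A \<alpha> \<beta> \<Longrightarrow> (\<Sum>i\<in>A. \<beta> i - \<alpha> i) < \<delta>1 \<Longrightarrow>
       (\<Sum>i\<in>A. \<bar>f (\<beta> i) - f (\<alpha> i)\<bar>) < \<epsilon> / (2 * C)"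
    by (rule abs_continuous_onD[OF f e, where 'i = nat]) blast
  obtain \<delta>2 where \<delta>2: "\<delta>2 > 0" "\<And>(A::nat set) \<alpha> \<beta>. nonoverlapping a b A \<alpha> \<beta> \<Longrightarrow> (\<Sum>i\<in>A. \<beta> i - \<alpha> i) < \<delta>2 \<Longrightarrow>
       (\<Sum>i\<in>A. \<bar>g (\<beta> i) - g (\<alpha> i)\<bar>) < \<epsilon> / (2 * C)"
    by (rule abs_continuous_onD[OF g e, where 'i = nat]) blast
  have "(\<Sum>i\<in>A. \<bar>h (\<beta> i) - h (\<alpha> i)\<bar>) < \<epsilon>"
    if A: "nonoverlapping a b A \<alpha> \<beta>" "(\<Sum>i\<in>A. \<beta> i - \<alpha> i) < min \<delta>1 \<delta>2" for A :: "nat set" and \<alpha> \<beta>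
  proof -
    have "(\<Sum>i\<in>A. \<bar>h (\<beta> i) - h (\<alpha> i)\<bar>)
        \<le> (\<Sum>i\<in>A. C * (\<bar>f (\<beta> i) - f (\<alpha> i)\<bar> + \<bar>g (\<beta> i) - g (\<alpha> i)\<bar>))"
      using A by (intro sum_mono le) (force simp: nonoverlapping_def)+
    also have "\<dots> = C * ((\<Sum>i\<in>A. \<bar>f (\<beta> i) - f (\<alpha> i)\<bar>) + (\<Sum>i\<in>A. \<bar>g (\<beta> i) - g (\<alpha> i)\<bar>))"
      by (simp add: sum_distrib_left sum.distrib distrib_left)
    also have "\<dots> < C * (\<epsilon> / (2 * C) + \<epsilon> / (2 * C))"
      using A C \<delta>1 \<delta>2 by (intro mult_strict_left_mono add_strict_mono) auto
    also have "\<dots> = \<epsilon>" using C by (simp add: field_simps)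
    finally show ?thesis .
  qed
  then show "\<exists>\<delta>>0. \<forall>(A::nat set) \<alpha> \<beta>. nonoverlapping a b A \<alpha> \<beta> \<longrightarrow> (\<Sum>i\<in>A. \<beta> i - \<alpha> i) < \<delta> \<longrightarrow>
       (\<Sum>i\<in>A. \<bar>h (\<beta> i) - h (\<alpha> i)\<bar>) < \<epsilon>"
    using \<delta>1(1) \<delta>2(1) by (intro exI[of _ "min \<delta>1 \<delta>2"]) auto
qed

lemma abs_continuous_on_cong:
  assumes "\<And>x. x \<in> {a..b} \<Longrightarrow> f x = g x" "abs_continuous_on {a..b} f"
  shows "abs_continuous_on {a..b} g"
  by (rule abs_continuous_on_bound[OF assms(2,2), of 1]) (use assms(1) in auto)

lemma abs_continuous_on_add:
  assumes "abs_continuous_on {a..b} f" "abs_continuous_on {a..b} g"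
  shows "abs_continuous_on {a..b} (\<lambda>x. f x + g x)"
  by (rule abs_continuous_on_bound[OF assms, of 1]) auto

lemma abs_continuous_on_diff:
  assumes "abs_continuous_on {a..b} f" "abs_continuous_on {a..b} g"
  shows "abs_continuous_on {a..b} (\<lambda>x. f x - g x)"
  by (rule abs_continuous_on_bound[OF assms, of 1]) auto

lemma abs_continuous_on_mult:
  assumes f: "abs_continuous_on {a..b} f" and g: "abs_continuous_on {a..b} g"
  shows "abs_continuous_on {a..b} (\<lambda>x. f x * g x)"
proof -
  have "bounded (f ` {a..b})" "bounded (g ` {a..b})"
    using assms by (auto intro!: compact_imp_bounded compact_continuous_image abs_continuous_on_imp_continuous_on)
  then obtain B1 B2 where B: "\<And>x. x \<in> {a..b} \<Longrightarrow> \<bar>f x\<bar> \<le> B1" "\<And>x. x \<in> {a..b} \<Longrightarrow> \<bar>g x\<bar> \<le> B2"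
    unfolding bounded_iff by (metis imageI real_norm_def)
  define C where "C = \<bar>B1\<bar> + \<bar>B2\<bar> + 1"
  show ?thesis
  proof (rule abs_continuous_on_bound[OF f g, of C])
    show "C > 0" by (simp add: C_def)
    fix x y assume xy: "x \<in> {a..b}" "y \<in> {a..b}"
    have "f y * g y - f x * g x = g y * (f y - f x) + f x * (g y - g x)" by algebra
    then have "\<bar>f y * g y - f x * g x\<bar> \<le> \<bar>g y\<bar> * \<bar>f y - f x\<bar> + \<bar>f x\<bar> * \<bar>g y - g x\<bar>"
      by (metis abs_mult abs_triangle_ineq)
    also have "\<dots> \<le> C * \<bar>f y - f x\<bar> + C * \<bar>g y - g x\<bar>"
      using B(1)[OF xy(1)] B(2)[OF xy(2)] by (intro add_mono mult_right_mono) (auto simp: C_def)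
    finally show "\<bar>f y * g y - f x * g x\<bar> \<le> C * (\<bar>f y - f x\<bar> + \<bar>g y - g x\<bar>)"
      by (simp add: distrib_left)
  qed
qed

text \<open>
  Truncation: \<open>\<bar>g\<bar>\<close> splits into a part bounded by \<open>n\<close>, which contributes at most \<open>n\<close> times the total
  length, and a remainder \<open>r n\<close> whose integral is small by dominated convergence.
\<close>

lemma abs_continuous_on_indefinite_integral:
  assumes g: "g absolutely_integrable_on {a..b}"
  shows "abs_continuous_on {a..b} (\<lambda>x. integral {a..x} (g :: real \<Rightarrow> real))"
proof (rule abs_continuous_onI)
  fix \<epsilon> :: real assume "\<epsilon> > 0"
  define r where "r n t = \<bar>g t\<bar> - min \<bar>g t\<bar> (real n)" for n t
  have gi: "g integrable_on {a..b}" and absg: "(\<lambda>t. \<bar>g t\<bar>) integrable_on {a..b}"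
    using g by (auto simp: absolutely_integrable_on_def)
  have min_int: "(\<lambda>t. min \<bar>g t\<bar> (real n)) absolutely_integrable_on {a..b}" for n
    using absolutely_integrable_min[OF absolutely_integrable_abs[OF g], of "\<lambda>_. real n"]
    by (simp add: absolutely_integrable_on_const)
  then have r_int: "r n integrable_on {a..b}" for n
    unfolding r_def by (intro integrable_diff absg) (simp add: absolutely_integrable_on_def)
  have "(\<lambda>n. integral {a..b} (r n)) \<longlonglongrightarrow> integral {a..b} (\<lambda>_. 0)"
  proof (rule dominated_convergence(2)[OF r_int absg])
    show "norm (r n t) \<le> \<bar>g t\<bar>" for n t by (auto simp: r_def)
    show "(\<lambda>n. r n t) \<longlonglongrightarrow> 0" for t
    proof (rule tendsto_eventually)
      obtain N where "\<bar>g t\<bar> \<le> real N" using real_arch_simple by blast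
      then show "\<forall>\<^sub>F n in sequentially. r n t = 0"
        unfolding eventually_sequentially r_def by (intro exI[of _ N]) (auto simp: min_def)
    qed
  qed
  then have "\<forall>\<^sub>F n in sequentially. integral {a..b} (r n) < \<epsilon> / 2"
    using \<open>\<epsilon> > 0\<close> by (intro order_tendstoD(2)) auto
  then obtain n where n: "integral {a..b} (r n) < \<epsilon> / 2"
    by (auto simp: eventually_sequentially)
  define \<delta> where "\<delta> = (\<epsilon> / 2) / (real n + 1)"
  have "(\<Sum>i\<in>A. \<bar>integral {a..\<beta> i} g - integral {a..\<alpha> i} g\<bar>) < \<epsilon>"
    if A: "nonoverlapping a b A \<alpha> \<beta>" and small: "(\<Sum>i\<in>A. \<beta> i - \<alpha> i) < \<delta>" for A :: "nat set" and \<alpha> \<beta>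
  proof -
    have "\<bar>integral {a..\<beta> i} g - integral {a..\<alpha> i} g\<bar> \<le> integral {\<alpha> i..\<beta> i} (r n) + real n * (\<beta> i - \<alpha> i)"
      if "i \<in> A" for i
    proof -
      have i: "a \<le> \<alpha> i" "\<alpha> i \<le> \<beta> i" "\<beta> i \<le> b" using A that by (auto simp: nonoverlapping_def)
      then have sub: "{\<alpha> i..\<beta> i} \<subseteq> {a..b}" by auto
      have "\<bar>integral {a..\<beta> i} g - integral {a..\<alpha> i} g\<bar> = norm (integral {\<alpha> i..\<beta> i} g)"
        using integral_diff_eq[OF gi i] by simp
      also have "\<dots> \<le> integral {\<alpha> i..\<beta> i} (\<lambda>t. r n t + real n)"
        using integrable_on_subinterval[OF gi sub] integrable_add[OF integrable_on_subinterval[OF r_int sub, of n], of "\<lambda>_. real n"]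
        by (intro integral_norm_bound_integral) (auto simp: r_def)
      also have "\<dots> = integral {\<alpha> i..\<beta> i} (r n) + real n * (\<beta> i - \<alpha> i)"
        using integrable_on_subinterval[OF r_int sub, of n] i by (subst integral_add) auto
      finally show ?thesis .
    qed
    then have "(\<Sum>i\<in>A. \<bar>integral {a..\<beta> i} g - integral {a..\<alpha> i} g\<bar>)
        \<le> (\<Sum>i\<in>A. integral {\<alpha> i..\<beta> i} (r n) + real n * (\<beta> i - \<alpha> i))"
      by (rule sum_mono)
    also have "\<dots> = (\<Sum>i\<in>A. integral {\<alpha> i..\<beta> i} (r n)) + real n * (\<Sum>i\<in>A. \<beta> i - \<alpha> i)"
      by (simp add: sum.distrib sum_distrib_left)
    also have "\<dots> \<le> integral {a..b} (r n) + real n * \<delta>"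
      using small by (intro add_mono sum_integral_nonoverlapping_le[OF A r_int] mult_left_mono) (auto simp: r_def)
    also have "\<dots> < \<epsilon> / 2 + (real n + 1) * \<delta>"
      using n \<open>\<epsilon> > 0\<close> by (intro add_strict_mono mult_strict_right_mono) (auto simp: \<delta>_def)
    also have "(real n + 1) * \<delta> = \<epsilon> / 2"
      using nonzero_mult_div_cancel_left[of "real n + 1" "\<epsilon> / 2"] by (simp add: \<delta>_def)
    finally show ?thesis by simp
  qed
  moreover have "\<delta> > 0" using \<open>\<epsilon> > 0\<close> by (simp add: \<delta>_def)
  ultimately show "\<exists>\<delta>>0. \<forall>(A::nat set) \<alpha> \<beta>. nonoverlapping a b A \<alpha> \<beta> \<longrightarrow> (\<Sum>i\<in>A. \<beta> i - \<alpha> i) < \<delta> \<longrightarrow>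
       (\<Sum>i\<in>A. \<bar>integral {a..\<beta> i} g - integral {a..\<alpha> i} g\<bar>) < \<epsilon>"
    by blast
qed

section \<open>Jordan decomposition of an absolutely continuous function\<close>

lemma nonoverlapping_combine:
  assumes A: "nonoverlapping x y A \<alpha> \<beta>"
    and B: "\<And>i. i \<in> A \<Longrightarrow> nonoverlapping (\<alpha> i) (\<beta> i) (B i) (\<alpha>' i) (\<beta>' i)"
  shows "nonoverlapping x y (Sigma A B) (\<lambda>(i, j). \<alpha>' i j) (\<lambda>(i, j). \<beta>' i j)"
  unfolding nonoverlapping_def
proof (intro conjI ballI)
  show "finite (Sigma A B)" using A B by (auto simp: nonoverlapping_def)
  show "x \<le> (case p of (i, j) \<Rightarrow> \<alpha>' i j)" "(case p of (i, j) \<Rightarrow> \<alpha>' i j) \<le> (case p of (i, j) \<Rightarrow> \<beta>' i j)"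
    "(case p of (i, j) \<Rightarrow> \<beta>' i j) \<le> y" if "p \<in> Sigma A B" for p
    using A B that unfolding nonoverlapping_def by force+
  have "{\<alpha>' i j<..<\<beta>' i j} \<inter> {\<alpha>' k l<..<\<beta>' k l} = {}"
    if *: "i \<in> A" "j \<in> B i" "k \<in> A" "l \<in> B k" "(i, j) \<noteq> (k, l)" for i j k l
  proof (cases "i = k")
    case True
    then show ?thesis using * B[of i] unfolding nonoverlapping_def disjoint_family_on_def by blast
  next
    case False
    have "{\<alpha>' i j<..<\<beta>' i j} \<subseteq> {\<alpha> i<..<\<beta> i}" "{\<alpha>' k l<..<\<beta>' k l} \<subseteq> {\<alpha> k<..<\<beta> k}"
      using * B[of i] B[of k] unfolding nonoverlapping_def by force+
    moreover have "{\<alpha> i<..<\<beta> i} \<inter> {\<alpha> k<..<\<beta> k} = {}"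
      using * A False unfolding nonoverlapping_def disjoint_family_on_def by blast
    ultimately show ?thesis by blast
  qed
  then show "disjoint_family_on (\<lambda>p. {(case p of (i, j) \<Rightarrow> \<alpha>' i j)<..<(case p of (i, j) \<Rightarrow> \<beta>' i j)}) (Sigma A B)"
    unfolding disjoint_family_on_def by auto
qed

text \<open>
  The supremum of this set is the positive variation of \<open>f\<close>. Signed sums suffice for that, since a
  family may leave out the intervals on which \<open>f\<close> decreases.
\<close>

definition increments :: "(real \<Rightarrow> real) \<Rightarrow> real \<Rightarrow> real \<Rightarrow> real set" where
  "increments f x y = {\<Sum>i\<in>A. f (\<beta> i) - f (\<alpha> i) |(A::nat set) \<alpha> \<beta>. nonoverlapping x y A \<alpha> \<beta>}"

lemma increments_mem:
  assumes A: "nonoverlapping x y (A::'i set) \<alpha> \<beta>"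
  shows "(\<Sum>i\<in>A. f (\<beta> i) - f (\<alpha> i)) \<in> increments f x y"
proof -
  have "finite A" using A by (simp add: nonoverlapping_def)
  then obtain h :: "nat \<Rightarrow> 'i" where h: "bij_betw h {..<card A} A"
    using bij_betw_from_nat_into_finite by blast
  have hA: "h k \<in> A" if "k < card A" for k using h that by (auto simp: bij_betw_def)
  have "h k \<noteq> h l" if "k < card A" "l < card A" "k \<noteq> l" for k l
    using h that by (auto simp: bij_betw_def inj_on_def)
  then have "disjoint_family_on (\<lambda>k. {\<alpha> (h k)<..<\<beta> (h k)}) {..<card A}"
    using A hA unfolding nonoverlapping_def disjoint_family_on_def by blast
  then have "nonoverlapping x y {..<card A} (\<alpha> \<circ> h) (\<beta> \<circ> h)"
    using A hA by (auto simp: nonoverlapping_def)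
  then have "(\<Sum>k<card A. f ((\<beta> \<circ> h) k) - f ((\<alpha> \<circ> h) k)) \<in> increments f x y"
    unfolding increments_def by blast
  also have "(\<Sum>k<card A. f ((\<beta> \<circ> h) k) - f ((\<alpha> \<circ> h) k)) = (\<Sum>i\<in>A. f (\<beta> i) - f (\<alpha> i))"
    using sum.reindex_bij_betw[OF h, of "\<lambda>i. f (\<beta> i) - f (\<alpha> i)"] by simp
  finally show ?thesis .
qed

lemma increments_zero: "0 \<in> increments f x y"
  using increments_mem[of x y "{} :: nat set"] by (simp add: nonoverlapping_def disjoint_family_on_def)

lemma increments_single:
  assumes "x \<le> y" shows "f y - f x \<in> increments f x y"
  using increments_mem[of x y "{()}" "\<lambda>_. x" "\<lambda>_. y" f] assms
  by (simp add: nonoverlapping_def disjoint_family_on_def)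

lemma increments_mono: "x' \<le> x \<Longrightarrow> y \<le> y' \<Longrightarrow> increments f x y \<subseteq> increments f x' y'"
  unfolding increments_def using nonoverlapping_mono by blast

text \<open>
  Refining each interval of a family keeps the total length from growing. This is what makes the
  positive variation inherit the absolute continuity of \<open>f\<close>.
\<close>

lemma increments_sum:
  assumes A: "nonoverlapping x y A \<alpha> \<beta>" and s: "\<And>i. i \<in> A \<Longrightarrow> s i \<in> increments f (\<alpha> i) (\<beta> i)"
  shows "\<exists>(B :: 'i \<Rightarrow> nat set) \<alpha>' \<beta>'. nonoverlapping x y (Sigma A B) (\<lambda>(i, j). \<alpha>' i j) (\<lambda>(i, j). \<beta>' i j) \<and>
      (\<Sum>i\<in>A. s i) = (\<Sum>p\<in>Sigma A B. f ((\<lambda>(i, j). \<beta>' i j) p) - f ((\<lambda>(i, j). \<alpha>' i j) p)) \<and>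
      (\<Sum>p\<in>Sigma A B. (\<lambda>(i, j). \<beta>' i j) p - (\<lambda>(i, j). \<alpha>' i j) p) \<le> (\<Sum>i\<in>A. \<beta> i - \<alpha> i)"
proof -
  have "\<forall>i\<in>A. \<exists>(B::nat set) \<alpha>' \<beta>'. nonoverlapping (\<alpha> i) (\<beta> i) B \<alpha>' \<beta>' \<and> s i = (\<Sum>j\<in>B. f (\<beta>' j) - f (\<alpha>' j))"
    using s unfolding increments_def by blast
  then obtain B :: "'i \<Rightarrow> nat set" and \<alpha>' \<beta>' where B: "\<And>i. i \<in> A \<Longrightarrow> nonoverlapping (\<alpha> i) (\<beta> i) (B i) (\<alpha>' i) (\<beta>' i)"
    and si: "\<And>i. i \<in> A \<Longrightarrow> s i = (\<Sum>j\<in>B i. f (\<beta>' i j) - f (\<alpha>' i j))"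
    by metis
  have fin: "finite A" "\<forall>i\<in>A. finite (B i)" using A B by (auto simp: nonoverlapping_def)
  have "(\<Sum>i\<in>A. s i) = (\<Sum>p\<in>Sigma A B. f ((\<lambda>(i, j). \<beta>' i j) p) - f ((\<lambda>(i, j). \<alpha>' i j) p))"
    using si by (simp add: sum.Sigma[OF fin, of "\<lambda>i j. f (\<beta>' i j) - f (\<alpha>' i j)"] case_prod_unfold cong: sum.cong)
  moreover have "(\<Sum>p\<in>Sigma A B. (\<lambda>(i, j). \<beta>' i j) p - (\<lambda>(i, j). \<alpha>' i j) p) \<le> (\<Sum>i\<in>A. \<beta> i - \<alpha> i)"
  proof -
    have "(\<Sum>p\<in>Sigma A B. (\<lambda>(i, j). \<beta>' i j) p - (\<lambda>(i, j). \<alpha>' i j) p) = (\<Sum>i\<in>A. \<Sum>j\<in>B i. \<beta>' i j - \<alpha>' i j)"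
      by (simp add: sum.Sigma[OF fin] case_prod_unfold)
    also have "\<dots> \<le> (\<Sum>i\<in>A. \<beta> i - \<alpha> i)"
      using A by (intro sum_mono sum_length_nonoverlapping_le[OF B]) (auto simp: nonoverlapping_def)
    finally show ?thesis .
  qed
  ultimately show ?thesis using nonoverlapping_combine[OF A B] by blast
qed

lemma increments_append:
  assumes "x \<le> y" "y \<le> z" "s1 \<in> increments f x y" "s2 \<in> increments f y z"
  shows "s1 + s2 \<in> increments f x z"
proof -
  let ?\<alpha> = "\<lambda>i. if i then x else y" and ?\<beta> = "\<lambda>i. if i then y else z" and ?s = "\<lambda>i. if i then s1 else s2"
  have "nonoverlapping x z UNIV ?\<alpha> ?\<beta>"
    using assms(1,2) by (auto simp: nonoverlapping_def disjoint_family_on_def)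
  moreover have "?s i \<in> increments f (?\<alpha> i) (?\<beta> i)" for i
    using assms(3,4) by simp
  ultimately obtain B :: "bool \<Rightarrow> nat set" and \<alpha>' \<beta>'
    where C: "nonoverlapping x z (Sigma UNIV B) (\<lambda>(i, j). \<alpha>' i j) (\<lambda>(i, j). \<beta>' i j)"
      "(\<Sum>i\<in>UNIV. ?s i) = (\<Sum>p\<in>Sigma UNIV B. f ((\<lambda>(i, j). \<beta>' i j) p) - f ((\<lambda>(i, j). \<alpha>' i j) p))"
    using increments_sum[of x z UNIV ?\<alpha> ?\<beta> ?s f] by blast
  then have "(\<Sum>i\<in>UNIV. ?s i) \<in> increments f x z"
    using increments_mem[OF C(1), of f] by simp
  then show ?thesis by (simp add: UNIV_bool add.commute)
qed

lemma increments_split: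
  assumes "s \<in> increments f x z" "x \<le> y" "y \<le> z"
  shows "\<exists>s1\<in>increments f x y. \<exists>s2\<in>increments f y z. s = s1 + s2"
proof -
  obtain A :: "nat set" and \<alpha> \<beta> where A: "nonoverlapping x z A \<alpha> \<beta>" and s: "s = (\<Sum>i\<in>A. f (\<beta> i) - f (\<alpha> i))"
    using assms(1) unfolding increments_def by blast
  have disj: "\<And>i j. i \<in> A \<Longrightarrow> j \<in> A \<Longrightarrow> i \<noteq> j \<Longrightarrow> {\<alpha> i<..<\<beta> i} \<inter> {\<alpha> j<..<\<beta> j} = {}"
    using A unfolding nonoverlapping_def disjoint_family_on_def by blast
  have sub: "{min (\<alpha> i) y<..<min (\<beta> i) y} \<subseteq> {\<alpha> i<..<\<beta> i}" "{max (\<alpha> i) y<..<max (\<beta> i) y} \<subseteq> {\<alpha> i<..<\<beta> i}" for i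
    by auto
  have "nonoverlapping x y A (\<lambda>i. min (\<alpha> i) y) (\<lambda>i. min (\<beta> i) y)"
    unfolding nonoverlapping_def disjoint_family_on_def
  proof (intro conjI ballI impI)
    show "finite A" using A by (simp add: nonoverlapping_def)
    show "x \<le> min (\<alpha> i) y" "min (\<alpha> i) y \<le> min (\<beta> i) y" "min (\<beta> i) y \<le> y" if "i \<in> A" for i
      using A that assms(2) by (auto simp: nonoverlapping_def min_def)
    show "{min (\<alpha> i) y<..<min (\<beta> i) y} \<inter> {min (\<alpha> j) y<..<min (\<beta> j) y} = {}"
      if "i \<in> A" "j \<in> A" "i \<noteq> j" for i j
      using disj[OF that] sub(1)[of i] sub(1)[of j] by blast
  qed
  moreover have "nonoverlapping y z A (\<lambda>i. max (\<alpha> i) y) (\<lambda>i. max (\<beta> i) y)"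
    unfolding nonoverlapping_def disjoint_family_on_def
  proof (intro conjI ballI impI)
    show "finite A" using A by (simp add: nonoverlapping_def)
    show "y \<le> max (\<alpha> i) y" "max (\<alpha> i) y \<le> max (\<beta> i) y" "max (\<beta> i) y \<le> z" if "i \<in> A" for i
      using A that assms(3) by (auto simp: nonoverlapping_def max_def)
    show "{max (\<alpha> i) y<..<max (\<beta> i) y} \<inter> {max (\<alpha> j) y<..<max (\<beta> j) y} = {}"
      if "i \<in> A" "j \<in> A" "i \<noteq> j" for i j
      using disj[OF that] sub(2)[of i] sub(2)[of j] by blast
  qed
  moreover have "s = (\<Sum>i\<in>A. f (min (\<beta> i) y) - f (min (\<alpha> i) y)) + (\<Sum>i\<in>A. f (max (\<beta> i) y) - f (max (\<alpha> i) y))"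
    unfolding s sum.distrib[symmetric] by (intro sum.cong) (auto simp: min_def max_def)
  ultimately show ?thesis using increments_mem by blast
qed

text \<open>
  On an interval shorter than the \<open>\<delta>\<close> that belongs to \<open>\<epsilon> = 1\<close> every sum is at most \<open>1\<close>, and \<open>{a..b}\<close> is
  exhausted by finitely many such intervals.
\<close>

lemma increments_bdd_above:
  assumes f: "abs_continuous_on {a..b} f" and "a \<le> b"
  shows "bdd_above (increments f a b)"
proof -
  obtain \<delta> where \<delta>: "\<delta> > 0" "\<And>(A::nat set) \<alpha> \<beta>. nonoverlapping a b A \<alpha> \<beta> \<Longrightarrow> (\<Sum>i\<in>A. \<beta> i - \<alpha> i) < \<delta> \<Longrightarrow>
       (\<Sum>i\<in>A. \<bar>f (\<beta> i) - f (\<alpha> i)\<bar>) < 1"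
    by (rule abs_continuous_onD[OF f zero_less_one, where 'i = nat]) blast
  have short: "s \<le> 1" if xy: "a \<le> x" "x \<le> y" "y \<le> b" "y - x < \<delta>" and s: "s \<in> increments f x y" for x y s
  proof -
    obtain A :: "nat set" and \<alpha> \<beta> where A: "nonoverlapping x y A \<alpha> \<beta>" and s': "s = (\<Sum>i\<in>A. f (\<beta> i) - f (\<alpha> i))"
      using s unfolding increments_def by blast
    have "s \<le> (\<Sum>i\<in>A. \<bar>f (\<beta> i) - f (\<alpha> i)\<bar>)" unfolding s' by (intro sum_mono) auto
    also have "\<dots> < 1"
      using sum_length_nonoverlapping_le[OF A] xy by (intro \<delta>(2) nonoverlapping_mono[OF A]) auto
    finally show ?thesis by simp
  qed
  define c where "c n = min b (a + real n * (\<delta>/2))" for n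
  have "bdd_above (increments f a (c n))" for n
  proof (induction n)
    case 0
    show ?case using short[of a a] \<delta>(1) \<open>a \<le> b\<close> by (intro bdd_aboveI[of _ 1]) (auto simp: c_def)
  next
    case (Suc n)
    then obtain M where M: "\<And>s. s \<in> increments f a (c n) \<Longrightarrow> s \<le> M" by (auto simp: bdd_above_def)
    have c: "a \<le> c n" "c n \<le> c (Suc n)" "c (Suc n) \<le> b" "c (Suc n) - c n < \<delta>"
    proof -
      define q where "q = a + real n * (\<delta>/2)"
      have "a \<le> q" using \<delta>(1) by (simp add: q_def)
      moreover have "c n = min b q" "c (Suc n) = min b (q + \<delta>/2)"
        by (simp_all add: c_def q_def algebra_simps add_divide_distrib)
      ultimately show "a \<le> c n" "c n \<le> c (Suc n)" "c (Suc n) \<le> b" "c (Suc n) - c n < \<delta>"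
        using \<delta>(1) \<open>a \<le> b\<close> by (auto simp: min_def)
    qed
    show ?case
    proof (rule bdd_aboveI)
      fix s assume "s \<in> increments f a (c (Suc n))"
      from increments_split[OF this c(1,2)] show "s \<le> M + 1"
        using M short[OF c] by (metis add_mono)
    qed
  qed
  moreover obtain n :: nat where "(b - a) / (\<delta>/2) \<le> real n" using real_arch_simple by blast
  then have "c n = b" using \<delta>(1) by (simp add: c_def field_simps)
  ultimately show ?thesis by metis
qed

definition pos_variation :: "(real \<Rightarrow> real) \<Rightarrow> real \<Rightarrow> real \<Rightarrow> real" where
  "pos_variation f x y = Sup (increments f x y)"

text \<open>
  Take for \<open>P x\<close> the positive variation on \<open>{a..x}\<close>. Superadditivity, applied to the empty family
  and to a single interval, makes \<open>P\<close> and \<open>P - f\<close> monotone; subadditivity bounds an increment of \<open>P\<close>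
  by the positive variation of \<open>f\<close> on that interval, whence absolute continuity.
\<close>

lemma jordan_decomposition_abs_continuous:
  assumes f: "abs_continuous_on {a..b} f" and "a \<le> b"
  obtains P where "abs_continuous_on {a..b} P" "mono_on {a..b} P" "mono_on {a..b} (\<lambda>x. P x - f x)"
proof -
  note bdd = increments_bdd_above[OF assms]
  have bdd': "bdd_above (increments f x y)" if "a \<le> x" "y \<le> b" for x y
    using bdd_above_mono[OF bdd increments_mono[OF that]] .
  have upper: "s \<le> pos_variation f x y" if "s \<in> increments f x y" "a \<le> x" "y \<le> b" for s x y
    unfolding pos_variation_def using that by (intro cSup_upper bdd') auto
  have nonempty: "increments f x y \<noteq> {}" for x y using increments_zero by blast
  define P where "P = pos_variation f a"
  have super: "P x + s \<le> P y" if xy: "a \<le> x" "x \<le> y" "y \<le> b" and s: "s \<in> increments f x y" for x y s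
  proof -
    have "P x \<le> P y - s"
      unfolding P_def pos_variation_def[of f a x]
    proof (rule cSup_least[OF nonempty])
      fix r assume "r \<in> increments f a x"
      then have "r + s \<in> increments f a y" using increments_append xy s by blast
      then show "r \<le> pos_variation f a y - s" using upper[of "r + s" a y] xy by auto
    qed
    then show ?thesis by simp
  qed
  have sub: "P y \<le> P x + pos_variation f x y" if xy: "a \<le> x" "x \<le> y" "y \<le> b" for x y
    unfolding P_def pos_variation_def[of f a y]
  proof (rule cSup_least[OF nonempty])
    fix r assume "r \<in> increments f a y"
    from increments_split[OF this xy(1,2)] obtain s1 s2
      where "s1 \<in> increments f a x" "s2 \<in> increments f x y" "r = s1 + s2" by blast
    then show "r \<le> pos_variation f a x + pos_variation f x y"
      using upper[of s1 a x] upper[of s2 x y] xy by auto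
  qed
  have monoP: "mono_on {a..b} P"
    using super[OF _ _ _ increments_zero] by (auto intro!: mono_onI)
  moreover have "mono_on {a..b} (\<lambda>x. P x - f x)"
    using super[OF _ _ _ increments_single] by (intro mono_onI) force
  moreover have "abs_continuous_on {a..b} P"
  proof (rule abs_continuous_onI)
    fix \<epsilon> :: real assume "\<epsilon> > 0"
    then have "\<epsilon> / 3 > 0" by simp
    obtain \<delta> where \<delta>: "\<delta> > 0" and ac: "\<And>(A::(nat \<times> nat) set) \<alpha> \<beta>. nonoverlapping a b A \<alpha> \<beta> \<Longrightarrow> (\<Sum>i\<in>A. \<beta> i - \<alpha> i) < \<delta> \<Longrightarrow>
       (\<Sum>i\<in>A. \<bar>f (\<beta> i) - f (\<alpha> i)\<bar>) < \<epsilon> / 3"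
      by (rule abs_continuous_onD[OF f \<open>\<epsilon> / 3 > 0\<close>, where 'i = "nat \<times> nat"]) blast
    have "(\<Sum>i\<in>A. \<bar>P (\<beta> i) - P (\<alpha> i)\<bar>) < \<epsilon>"
      if A: "nonoverlapping a b A \<alpha> \<beta>" and small: "(\<Sum>i\<in>A. \<beta> i - \<alpha> i) < \<delta>" for A :: "nat set" and \<alpha> \<beta>
    proof -
      have ab: "a \<le> \<alpha> i" "\<alpha> i \<le> \<beta> i" "\<beta> i \<le> b" if "i \<in> A" for i
        using A that by (auto simp: nonoverlapping_def)
      \<comment> \<open>Each positive variation is attained up to \<open>\<eta>\<close>, chosen so that all errors together stay below \<open>\<epsilon> / 3\<close>.\<close>
      define \<eta> where "\<eta> = (\<epsilon> / 3) / (real (card A) + 1)"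
      have "\<eta> > 0" using \<open>\<epsilon> > 0\<close> by (simp add: \<eta>_def)
      have "\<exists>s\<in>increments f (\<alpha> i) (\<beta> i). pos_variation f (\<alpha> i) (\<beta> i) - \<eta> < s" for i
      proof -
        have "pos_variation f (\<alpha> i) (\<beta> i) - \<eta> < Sup (increments f (\<alpha> i) (\<beta> i))"
          using \<open>\<eta> > 0\<close> by (simp add: pos_variation_def)
        then show ?thesis by (rule less_cSupE[OF _ nonempty]) blast
      qed
      then obtain s where s: "\<And>i. s i \<in> increments f (\<alpha> i) (\<beta> i)" "\<And>i. pos_variation f (\<alpha> i) (\<beta> i) - \<eta> < s i"
        by metis
      from increments_sum[OF A, of s f] s(1) obtain B :: "nat \<Rightarrow> nat set" and \<alpha>' \<beta>' where
        B: "nonoverlapping a b (Sigma A B) (\<lambda>(i, j). \<alpha>' i j) (\<lambda>(i, j). \<beta>' i j)"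
        "(\<Sum>i\<in>A. s i) = (\<Sum>p\<in>Sigma A B. f ((\<lambda>(i, j). \<beta>' i j) p) - f ((\<lambda>(i, j). \<alpha>' i j) p))"
        "(\<Sum>p\<in>Sigma A B. (\<lambda>(i, j). \<beta>' i j) p - (\<lambda>(i, j). \<alpha>' i j) p) \<le> (\<Sum>i\<in>A. \<beta> i - \<alpha> i)"
        by blast
      have "(\<Sum>i\<in>A. s i) \<le> (\<Sum>p\<in>Sigma A B. \<bar>f ((\<lambda>(i, j). \<beta>' i j) p) - f ((\<lambda>(i, j). \<alpha>' i j) p)\<bar>)"
        unfolding B(2) by (intro sum_mono) auto
      also have "\<dots> < \<epsilon> / 3" using B(3) small by (intro ac[OF B(1)]) auto
      finally have S: "(\<Sum>i\<in>A. s i) < \<epsilon> / 3" .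
      have "(\<Sum>i\<in>A. \<bar>P (\<beta> i) - P (\<alpha> i)\<bar>) \<le> (\<Sum>i\<in>A. s i + \<eta>)"
      proof (rule sum_mono)
        fix i assume i: "i \<in> A"
        have "P (\<alpha> i) \<le> P (\<beta> i)" using super[OF ab[OF i] increments_zero] by simp
        then show "\<bar>P (\<beta> i) - P (\<alpha> i)\<bar> \<le> s i + \<eta>" using sub[OF ab[OF i]] s(2)[of i] by linarith
      qed
      also have "\<dots> = (\<Sum>i\<in>A. s i) + real (card A) * \<eta>" by (simp add: sum.distrib)
      also have "real (card A) * \<eta> \<le> (real (card A) + 1) * \<eta>" using \<open>\<eta> > 0\<close> by simp
      also have "(real (card A) + 1) * \<eta> = \<epsilon> / 3"
          using nonzero_mult_div_cancel_left[of "real (card A) + 1" "\<epsilon> / 3"] by (simp add: \<eta>_def)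
      finally show ?thesis using S \<open>\<epsilon> > 0\<close> by simp
    qed
    then show "\<exists>\<delta>>0. \<forall>(A::nat set) \<alpha> \<beta>. nonoverlapping a b A \<alpha> \<beta> \<longrightarrow> (\<Sum>i\<in>A. \<beta> i - \<alpha> i) < \<delta> \<longrightarrow>
       (\<Sum>i\<in>A. \<bar>P (\<beta> i) - P (\<alpha> i)\<bar>) < \<epsilon>"
      using \<delta> by blast
  qed
  ultimately show thesis using that by blast
qed

section \<open>The fundamental theorem for absolutely continuous functions\<close>

text \<open>
  A null set lies in an open set \<open>U\<close> of length less than \<open>\<delta>\<close>. Countably many nonoverlapping intervals
  inside \<open>U\<close> cover it, and on every finite subfamily \<open>F\<close> increases by less than \<open>\<epsilon>\<close>.
\<close>

lemma mono_abs_continuous_null: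
  assumes ac: "abs_continuous_on {a..b} F" and "a < b"
    and H: "\<And>x y. x \<le> y \<Longrightarrow> H x \<le> H y" "continuous_on UNIV H" "\<And>x. x \<in> {a..b} \<Longrightarrow> H x = (F x :: real)"
    and N: "N \<in> null_sets lborel" "N \<subseteq> {a..b}"
  shows "emeasure (interval_measure H) N = 0"
proof -
  let ?\<mu> = "interval_measure H"
  have Icc: "emeasure ?\<mu> {x..y} = ennreal (H y - H x)" if "x \<le> y" for x y
    using that H by (intro emeasure_interval_measure_Icc) auto
  have Nb: "N \<in> sets borel" using N by auto
  have "emeasure ?\<mu> N \<le> 0 + ennreal \<epsilon>" if "\<epsilon> > 0" for \<epsilon> :: real
  proof -
    obtain \<delta> where \<delta>: "\<delta> > 0" "\<And>(A::real set set) \<alpha> \<beta>. nonoverlapping a b A \<alpha> \<beta> \<Longrightarrow> (\<Sum>i\<in>A. \<beta> i - \<alpha> i) < \<delta> \<Longrightarrow>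
       (\<Sum>i\<in>A. \<bar>F (\<beta> i) - F (\<alpha> i)\<bar>) < \<epsilon>"
      by (rule abs_continuous_onD[OF ac \<open>\<epsilon> > 0\<close>, where 'i = "real set"]) blast
    obtain U where U: "open U" "N \<subseteq> U" "emeasure lborel (U - N) < ennreal \<delta>"
      using outer_regular_lborel[OF Nb, of "\<delta>"] \<delta>(1) by auto
    have "emeasure lborel U \<le> emeasure lborel ((U - N) \<union> N)"
      using U Nb by (intro emeasure_mono) auto
    also have "\<dots> \<le> emeasure lborel (U - N) + emeasure lborel N"
      using U Nb by (intro emeasure_subadditive) auto
    also have "\<dots> < ennreal \<delta>" using U N by (simp add: null_setsD1)
    finally have mU: "emeasure lborel U < ennreal \<delta>" .
    \<comment> \<open>Fineness with respect to \<open>\<gamma>\<close> confines the covering intervals to \<open>U\<close>.\<close>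
    define \<gamma> where "\<gamma> x = (if x \<in> U then U else UNIV)" for x
    have "gauge \<gamma>" using U by (auto simp: gauge_def \<gamma>_def)
    moreover have "N \<subseteq> cbox a b" "box a b \<noteq> {}" using N \<open>a < b\<close> by (auto simp: cbox_interval)
    ultimately obtain \<D> where \<D>: "countable \<D>" "\<Union>\<D> \<subseteq> cbox a b"
      "\<And>K. K \<in> \<D> \<Longrightarrow> interior K \<noteq> {} \<and> (\<exists>c d. K = cbox c d)"
      "pairwise (\<lambda>A B. interior A \<inter> interior B = {}) \<D>"
      "\<And>K. K \<in> \<D> \<Longrightarrow> \<exists>x \<in> N \<inter> K. K \<subseteq> \<gamma> x"
      "N \<subseteq> \<Union>\<D>"
      using covering_lemma[of N a b \<gamma>] by (metis (no_types, lifting))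
    have K: "K = {Inf K..Sup K} \<and> Inf K < Sup K \<and> interior K = {Inf K<..<Sup K} \<and> K \<subseteq> U \<and> K \<subseteq> {a..b}" if KD: "K \<in> \<D>" for K
    proof -
      obtain c d where cd: "K = {c..d}" using \<D>(3)[OF KD] by (auto simp: cbox_interval)
      then have "c < d" using \<D>(3)[OF KD] by (auto simp: interior_atLeastAtMost_real)
      moreover have "K \<subseteq> U" using \<D>(5)[OF KD] U(2) by (auto simp: \<gamma>_def split: if_splits)
      moreover have "K \<subseteq> {a..b}" using \<D>(2) KD by (auto simp: cbox_interval)
      ultimately show ?thesis using cd by (auto simp: interior_atLeastAtMost_real)
    qed
    have fin: "emeasure ?\<mu> (\<Union>\<F>) \<le> ennreal \<epsilon>" if \<F>: "\<F> \<subseteq> \<D>" "finite \<F>" for \<F>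
    proof -
      have disj: "disjoint_family_on (\<lambda>K. {Inf K<..<Sup K}) \<F>"
        unfolding disjoint_family_on_def
      proof (intro ballI impI)
        fix A B assume AB: "A \<in> \<F>" "B \<in> \<F>" "A \<noteq> B"
        then have "interior A \<inter> interior B = {}"
          using \<D>(4) \<F>(1) by (meson pairwiseD subsetD)
        moreover have "interior A = {Inf A<..<Sup A}" "interior B = {Inf B<..<Sup B}"
          using K \<F>(1) AB by (meson subsetD)+
        ultimately show "{Inf A<..<Sup A} \<inter> {Inf B<..<Sup B} = {}" by simp
      qed
      have "a \<le> Inf A \<and> Inf A \<le> Sup A \<and> Sup A \<le> b" if "A \<in> \<F>" for A
      proof -
        have "A = {Inf A..Sup A}" "Inf A < Sup A" "A \<subseteq> {a..b}" using K[of A] \<F> that by auto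
        then show ?thesis by (metis atLeastatMost_subset_iff less_imp_le)
      qed
      then have no: "nonoverlapping a b \<F> Inf Sup"
        using \<F> disj unfolding nonoverlapping_def by blast
      have "ennreal (\<Sum>A\<in>\<F>. Sup A - Inf A) = (\<Sum>A\<in>\<F>. emeasure lborel {Inf A<..<Sup A})"
        using no by (subst sum_ennreal[symmetric]) (auto simp: nonoverlapping_def)
      also have "\<dots> = emeasure lborel (\<Union>A\<in>\<F>. {Inf A<..<Sup A})"
        using disj \<F> by (intro sum_emeasure) auto
      also have "\<dots> \<le> emeasure lborel U"
      proof (rule emeasure_mono)
        have "{Inf A<..<Sup A} \<subseteq> U" if "A \<in> \<F>" for A
        proof -
          have "A \<in> \<D>" using that \<F>(1) by blast
          from K[OF this] have "{Inf A<..<Sup A} = interior A" "A \<subseteq> U" by blast+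
          then show ?thesis using interior_subset[of A] by simp
        qed
        then show "(\<Union>A\<in>\<F>. {Inf A<..<Sup A}) \<subseteq> U" by blast
      qed (use U in auto)
      finally have "ennreal (\<Sum>A\<in>\<F>. Sup A - Inf A) < ennreal \<delta>" using mU by (rule le_less_trans)
      moreover have "0 \<le> (\<Sum>A\<in>\<F>. Sup A - Inf A)"
        using no by (intro sum_nonneg) (auto simp: nonoverlapping_def)
      ultimately have "(\<Sum>A\<in>\<F>. Sup A - Inf A) < \<delta>" by (simp add: ennreal_less_iff)
      then have small: "(\<Sum>A\<in>\<F>. \<bar>F (Sup A) - F (Inf A)\<bar>) < \<epsilon>" by (rule \<delta>(2)[OF no])
      have "\<Union>\<F> = (\<Union>A\<in>\<F>. {Inf A..Sup A})" using K \<F> by blast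
      then have "emeasure ?\<mu> (\<Union>\<F>) \<le> (\<Sum>A\<in>\<F>. emeasure ?\<mu> {Inf A..Sup A})"
        using \<F> by (auto intro!: emeasure_subadditive_finite)
      also have "\<dots> = (\<Sum>A\<in>\<F>. ennreal (\<bar>F (Sup A) - F (Inf A)\<bar>))"
      proof (rule sum.cong[OF refl])
        fix A assume A: "A \<in> \<F>"
        then have i: "a \<le> Inf A" "Inf A \<le> Sup A" "Sup A \<le> b" using no by (auto simp: nonoverlapping_def)
        then have "H (Sup A) - H (Inf A) = \<bar>F (Sup A) - F (Inf A)\<bar>"
          using H(1)[of "Inf A" "Sup A"] H(3)[of "Inf A"] H(3)[of "Sup A"] by auto
        then show "emeasure ?\<mu> {Inf A..Sup A} = ennreal (\<bar>F (Sup A) - F (Inf A)\<bar>)"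
          using Icc[OF i(2)] by simp
      qed
      also have "\<dots> = ennreal (\<Sum>A\<in>\<F>. \<bar>F (Sup A) - F (Inf A)\<bar>)" by (rule sum_ennreal) auto
      also have "\<dots> \<le> ennreal \<epsilon>" using small by (intro ennreal_leI) auto
      finally show ?thesis .
    qed
    have Db: "K \<in> sets borel" if "K \<in> \<D>" for K using K[OF that] by (metis borel_closed closed_atLeastAtMost)
    have "emeasure ?\<mu> (\<Union>\<D>) \<le> ennreal \<epsilon>"
    proof (cases "\<D> = {}")
      case False
      define e where "e = from_nat_into \<D>"
      have e: "range e = \<D>" using range_from_nat_into[OF False \<D>(1)] by (simp add: e_def)
      have inc: "incseq (\<lambda>n. \<Union>(e ` {..n}))" by (intro incseq_SucI) (auto simp: atMost_Suc)
      have sets: "range (\<lambda>n. \<Union>(e ` {..n})) \<subseteq> sets ?\<mu>"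
        using e Db by (auto intro!: sets.finite_UN)
      have "(\<Union>n. \<Union>(e ` {..n})) = \<Union>\<D>" using e by blast
      then have "emeasure ?\<mu> (\<Union>\<D>) = (SUP n. emeasure ?\<mu> (\<Union>(e ` {..n})))"
        using SUP_emeasure_incseq[OF sets inc] by simp
      also have "\<dots> \<le> ennreal \<epsilon>" using e by (intro SUP_least fin) auto
      finally show ?thesis .
    qed simp
    moreover have "emeasure ?\<mu> N \<le> emeasure ?\<mu> (\<Union>\<D>)"
      using \<D>(1,6) Db by (intro emeasure_mono) (auto intro!: sets.countable_Union)
    ultimately show ?thesis by simp
  qed
  then have "emeasure ?\<mu> N \<le> 0" by (rule ennreal_le_epsilon) auto
  then show ?thesis by simp
qed

text \<open>
  The integrand is the Radon--Nikodym density of the Stieltjes measure of \<open>F\<close>, which does not charge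
  Lebesgue null sets by \<open>mono_abs_continuous_null\<close>.
\<close>

lemma mono_abs_continuous_integral:
  assumes ac: "abs_continuous_on {a..b} F" and mono: "mono_on {a..b} F"
  obtains g where "g absolutely_integrable_on {a..b}" "\<And>x. x \<in> {a..b} \<Longrightarrow> F x = F a + integral {a..x} g"
proof (cases "a < b")
  case False
  show thesis
  proof
    show "(\<lambda>_. 0::real) absolutely_integrable_on {a..b}" by (simp add: set_integrable_def)
    show "F x = F a + integral {a..x} (\<lambda>_. 0)" if "x \<in> {a..b}" for x
    proof -
      have "x = a" using that False by auto
      then show ?thesis by simp
    qed
  qed
next
  case True
  \<comment> \<open>Extension by constants, since Stieltjes measures are attached to functions on the whole line.\<close>
  define H where "H x = F (max a (min b x))" for x
  have H_eq: "H x = F x" if "x \<in> {a..b}" for x using that by (auto simp: H_def)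
  have H_mono: "H x \<le> H y" if "x \<le> y" for x y
    unfolding H_def using that True by (intro mono_onD[OF mono]) auto
  have H_cont: "continuous_on UNIV H"
    unfolding H_def
    by (rule continuous_on_compose2[OF abs_continuous_on_imp_continuous_on[OF ac]])
      (use True in \<open>auto intro!: continuous_intros\<close>)
  let ?\<mu> = "interval_measure H"
  have Icc: "emeasure ?\<mu> {x..y} = ennreal (H y - H x)" if "x \<le> y" for x y
    using that H_mono H_cont by (intro emeasure_interval_measure_Icc) auto
  have "absolutely_continuous lborel ?\<mu>"
    unfolding absolutely_continuous_def
  proof
    fix N :: "real set" assume N: "N \<in> null_sets lborel"
    have "N \<inter> {a..b} \<in> null_sets lborel" using N by (rule null_set_Int2) auto
    then have "emeasure ?\<mu> (N \<inter> {a..b}) = 0"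
      by (intro mono_abs_continuous_null[OF ac True H_mono H_cont H_eq]) auto
    moreover have "N \<inter> {a..b} \<in> sets ?\<mu>" using N by auto
    ultimately have "N \<inter> {a..b} \<in> null_sets ?\<mu>" by (rule null_setsI)
    moreover have "{b..b + real n} \<in> null_sets ?\<mu>" "{a - real n..a} \<in> null_sets ?\<mu>" for n
      using True by (auto intro!: null_setsI simp: Icc H_def min_def max_def)
    then have "(\<Union>n. {b..b + real n} \<union> {a - real n..a}) \<in> null_sets ?\<mu>"
      by (intro null_sets_UN null_sets.Un)
    ultimately have "N \<inter> {a..b} \<union> (\<Union>n. {b..b + real n} \<union> {a - real n..a}) \<in> null_sets ?\<mu>"
      by (rule null_sets.Un)
    moreover have "N \<subseteq> N \<inter> {a..b} \<union> (\<Union>n. {b..b + real n} \<union> {a - real n..a})"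
    proof
      fix x assume "x \<in> N"
      obtain n where "\<bar>x - a\<bar> + \<bar>x - b\<bar> \<le> real n" using real_arch_simple by blast
      then have "x \<in> {a..b} \<or> x \<in> {b..b + real n} \<union> {a - real n..a}" by auto
      with \<open>x \<in> N\<close> show "x \<in> N \<inter> {a..b} \<union> (\<Union>n. {b..b + real n} \<union> {a - real n..a})" by blast
    qed
    moreover have "N \<in> sets ?\<mu>" using N by auto
    ultimately show "N \<in> null_sets ?\<mu>" by (meson null_sets_subset)
  qed
  then obtain f where f: "f \<in> borel_measurable lborel" "density lborel f = ?\<mu>"
    using sigma_finite_measure.Radon_Nikodym[OF sigma_finite_lborel, of ?\<mu>] by auto
  have nn: "(\<integral>\<^sup>+t. f t * indicator {a..x} t \<partial>lborel) = ennreal (F x - F a)" if x: "x \<in> {a..b}" for x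
  proof -
    have "(\<integral>\<^sup>+t. f t * indicator {a..x} t \<partial>lborel) = emeasure (density lborel f) {a..x}"
      using f by (intro emeasure_density[symmetric]) auto
    also have "\<dots> = ennreal (F x - F a)"
      unfolding f(2) using x Icc[of a x] H_eq[of x] H_eq[of a] True by auto
    finally show ?thesis .
  qed
  define g where "g t = enn2real (f t)" for t
  have gm: "g \<in> borel_measurable borel" 
    unfolding g_def[abs_def] using f(1) by measurable
  have g0: "0 \<le> g t" for t by (simp add: g_def)
  have "AE t in lborel. f t * indicator {a..b} t \<noteq> \<infinity>"
    using f(1) nn[of b] True by (intro nn_integral_noteq_infinite) auto
  then have fin: "AE t in lborel. t \<in> {a..b} \<longrightarrow> ennreal (g t) = f t"
    by eventually_elim (auto simp: g_def less_top)
  have bi: "has_bochner_integral lborel (\<lambda>t. indicator {a..x} t *\<^sub>R g t) (F x - F a)" if x: "x \<in> {a..b}" for x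
  proof (rule has_bochner_integral_nn_integral)
    show "0 \<le> F x - F a" using x mono_onD[OF mono, of a x] by auto
    have "(\<integral>\<^sup>+t. ennreal (indicator {a..x} t *\<^sub>R g t) \<partial>lborel) = (\<integral>\<^sup>+t. f t * indicator {a..x} t \<partial>lborel)"
    proof (rule nn_integral_cong_AE)
      show "AE t in lborel. ennreal (indicator {a..x} t *\<^sub>R g t) = f t * indicator {a..x} t"
        using fin by eventually_elim (use x in \<open>auto split: split_indicator\<close>)
    qed
    then show "(\<integral>\<^sup>+t. ennreal (indicator {a..x} t *\<^sub>R g t) \<partial>lborel) = ennreal (F x - F a)"
      using nn[OF x] by simp
  qed (use gm g0 in auto)
  show thesis
  proof
    have "set_integrable lborel {a..b} g"
      using bi[of b] True unfolding set_integrable_def by (auto simp: has_bochner_integral_iff)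
    then show "g absolutely_integrable_on {a..b}"
      unfolding set_integrable_def using gm
      by (subst integrable_completion) auto
    fix x assume x: "x \<in> {a..b}"
    have "set_integrable lborel {a..x} g" "(LINT t:{a..x}|lborel. g t) = F x - F a"
      using bi[OF x] unfolding set_integrable_def set_lebesgue_integral_def
      by (auto simp: has_bochner_integral_iff)
    then show "F x = F a + integral {a..x} g"
      using set_borel_integral_eq_integral[of "{a..x}" g] by simp
  qed
qed

theorem abs_continuous_on_imp_integral:
  assumes f: "abs_continuous_on {a..b} f"
  obtains g where "g absolutely_integrable_on {a..b}" "\<And>x. x \<in> {a..b} \<Longrightarrow> f x = f a + integral {a..x} g"
proof (cases "a \<le> b")
  case False
  show thesis
  proof (rule that)
    show "(\<lambda>_. 0::real) absolutely_integrable_on {a..b}" by (simp add: set_integrable_def)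
    fix x assume "x \<in> {a..b}"
    then have False using False by (meson atLeastAtMost_iff order_trans)
    then show "f x = f a + integral {a..x} (\<lambda>_. 0)" ..
  qed
next
  case True
  obtain P where P: "abs_continuous_on {a..b} P" "mono_on {a..b} P" "mono_on {a..b} (\<lambda>x. P x - f x)"
    using jordan_decomposition_abs_continuous[OF f True] .
  obtain g where g: "g absolutely_integrable_on {a..b}" "\<And>x. x \<in> {a..b} \<Longrightarrow> P x = P a + integral {a..x} g"
    using mono_abs_continuous_integral[OF P(1,2)] by blast
  obtain h where h: "h absolutely_integrable_on {a..b}"
    "\<And>x. x \<in> {a..b} \<Longrightarrow> P x - f x = P a - f a + integral {a..x} h"
    using mono_abs_continuous_integral[OF abs_continuous_on_diff[OF P(1) f] P(3)] by blast
  have gh: "g integrable_on {a..b}" "h integrable_on {a..b}" using g(1) h(1) by (auto simp: absolutely_integrable_on_def)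
  show thesis
  proof (rule that)
    show "(\<lambda>t. g t - h t) absolutely_integrable_on {a..b}"
      using g(1) h(1) by (rule set_integral_diff(1))
    fix x assume x: "x \<in> {a..b}"
    then have "{a..x} \<subseteq> {a..b}" by auto
    then have "integral {a..x} (\<lambda>t. g t - h t) = integral {a..x} g - integral {a..x} h"
      using gh by (intro integral_diff) (blast intro: integrable_on_subinterval)+
    then show "f x = f a + integral {a..x} (\<lambda>t. g t - h t)"
      using g(2)[OF x] h(2)[OF x] by simp
  qed
qed

corollary abs_continuous_on_differentiable_ae:
  assumes f: "abs_continuous_on {a..b} f"
  obtains N where "negligible N" "\<And>t. t \<in> {a..b} - N \<Longrightarrow> f differentiable (at t within {a..b})"
proof -
  obtain g where g: "g absolutely_integrable_on {a..b}" "\<And>x. x \<in> {a..b} \<Longrightarrow> f x = f a + integral {a..x} g"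
    using abs_continuous_on_imp_integral[OF f] by blast
  from g(1) have "g integrable_on {a..b}" by (simp add: absolutely_integrable_on_def)
  then obtain N where N: "negligible N"
    "\<And>t. t \<in> {a..b} - N \<Longrightarrow> ((\<lambda>x. integral {a..x} g) has_real_derivative g t) (at t within {a..b})"
    using indefinite_integral_has_derivative_ae by metis
  have "f differentiable (at t within {a..b})" if t: "t \<in> {a..b} - N" for t
  proof -
    have "((\<lambda>x. f a + integral {a..x} g) has_real_derivative g t) (at t within {a..b})"
      using DERIV_add[OF DERIV_const N(2)[OF t]] by simp
    then have "(f has_real_derivative g t) (at t within {a..b})"
      by (rule has_field_derivative_transform_within[OF _ zero_less_one]) (use t in \<open>auto simp: g(2)[symmetric]\<close>)
    then show ?thesis using real_differentiable_def by blast
  qed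
  with N(1) show thesis by (rule that)
qed

text \<open>
  The density provided by \<open>abs_continuous_on_imp_integral\<close> is a derivative of \<open>f\<close> almost everywhere and
  therefore agrees with \<open>h\<close> outside a null set.
\<close>

theorem abs_continuous_on_ftc:
  assumes f: "abs_continuous_on {a..b} f" and N: "negligible N"
    and der: "\<And>t. t \<in> {a..b} - N \<Longrightarrow> (f has_real_derivative h t) (at t within {a..b})"
  shows "h absolutely_integrable_on {a..b}" "\<And>x. x \<in> {a..b} \<Longrightarrow> f x = f a + integral {a..x} h"
proof -
  obtain g where g: "g absolutely_integrable_on {a..b}" "\<And>x. x \<in> {a..b} \<Longrightarrow> f x = f a + integral {a..x} g"
    using abs_continuous_on_imp_integral[OF f] by blast
  from g(1) have "g integrable_on {a..b}" by (simp add: absolutely_integrable_on_def)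
  then obtain M where M: "negligible M"
    "\<And>t. t \<in> {a..b} - M \<Longrightarrow> ((\<lambda>x. integral {a..x} g) has_real_derivative g t) (at t within {a..b})"
    using indefinite_integral_has_derivative_ae by metis
  define Z where "Z = M \<union> N \<union> {a, b}"
  have Z: "negligible Z" using M N by (auto simp: Z_def)
  have eq: "h t = g t" if t: "t \<in> {a..b} - Z" for t
  proof -
    have t': "t \<in> {a..b} - M" "t \<in> {a..b} - N" "a < t" "t < b" using t by (auto simp: Z_def)
    have "((\<lambda>x. f a + integral {a..x} g) has_real_derivative g t) (at t within {a..b})"
      using DERIV_add[OF DERIV_const M(2)[OF t'(1)]] by simp
    then have "(f has_real_derivative g t) (at t within {a..b})"
      by (rule has_field_derivative_transform_within[OF _ zero_less_one]) (use t in \<open>auto simp: g(2)[symmetric]\<close>)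
    moreover have "at t within {a..b} = at t" using t' by (intro at_within_Icc_at)
    ultimately show ?thesis using der[OF t'(2)] DERIV_unique by metis
  qed
  show "h absolutely_integrable_on {a..b}"
    by (rule absolutely_integrable_spike[OF g(1) Z]) (use eq in auto)
  fix x assume x: "x \<in> {a..b}"
  have "integral {a..x} g = integral {a..x} h"
    by (rule integral_spike[OF Z]) (use eq x in auto)
  then show "f x = f a + integral {a..x} h" using g(2)[OF x] by simp
qed

section \<open>Picard iteration with a parameter\<close>

text \<open>
  The substitution \<open>s = t \<tau>\<close> moves the variable upper limit into the integrand.
\<close>

lemma continuous_on_indefinite_integral_param:
  fixes h :: "real \<Rightarrow> 'p::metric_space \<Rightarrow> 'a::banach"
  assumes h: "continuous_on ({0..1} \<times> K) (\<lambda>(s, p). h s p)"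
  shows "continuous_on ({0..1} \<times> K) (\<lambda>(t, p). integral {0..t} (\<lambda>s. h s p))"
proof -
  have sub: "integral {0..t} (\<lambda>s. h s p) = t *\<^sub>R integral {0..1} (\<lambda>\<tau>. h (t * \<tau>) p)"
    if "t \<in> {0..1}" "p \<in> K" for t p
  proof (cases "t = 0")
    case False
    then have "t > 0" using that by auto
    have "continuous_on {0..t} (\<lambda>s. h s p)"
      by (rule continuous_on_compose2[OF h, of _ "\<lambda>s. (s, p)", simplified])
        (use that in \<open>auto intro!: continuous_intros\<close>)
    then have "((\<lambda>s. h s p) has_integral integral {0..t} (\<lambda>s. h s p)) (cbox 0 t)"
      by (simp add: cbox_interval integrable_integral integrable_continuous_real)
    from has_integral_affinity[OF this, of t 0] \<open>t > 0\<close>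
    have "((\<lambda>\<tau>. h (t * \<tau>) p) has_integral (1/t) *\<^sub>R integral {0..t} (\<lambda>s. h s p)) ((\<lambda>x. x / t) ` {0..t})"
      by (simp add: cbox_interval divide_inverse_commute)
    moreover have "(\<lambda>x. x / t) ` {0..t} = {0..1}"
      using \<open>t > 0\<close> by simp
    ultimately show ?thesis using \<open>t > 0\<close> by (simp add: integral_unique)
  qed simp
  have "continuous_on (({0..1} \<times> K) \<times> cbox 0 1) (\<lambda>(q, \<tau>). h (fst q * \<tau>) (snd q))"
    unfolding case_prod_unfold
    by (rule continuous_on_compose2[OF h[unfolded case_prod_unfold], of _ "\<lambda>x. (fst (fst x) * snd x, snd (fst x))", simplified])
      (auto intro!: continuous_intros mult_le_one)
  from integral_continuous_on_param[OF this]
  have "continuous_on ({0..1} \<times> K) (\<lambda>q. fst q *\<^sub>R integral {0..1} (\<lambda>\<tau>. h (fst q * \<tau>) (snd q)))"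
    by (auto intro!: continuous_intros simp: cbox_interval)
  then show ?thesis
    by (rule continuous_on_eq) (auto simp: sub)
qed

text \<open>
  Every iterate is continuous in time and parameter together, and convergence is uniform in both, so the
  solution inherits joint continuity. In the norm weighted by \<open>exp (2 M t)\<close> the Picard operator
  contracts with factor \<open>1/2\<close> on all of \<open>{0..1}\<close>, which avoids patching short intervals.
\<close>

theorem picard_param:
  fixes B :: "real \<Rightarrow> 'p::metric_space \<Rightarrow> 'a::banach \<Rightarrow> 'a"
  assumes B: "continuous_on ({0..1} \<times> K \<times> UNIV) (\<lambda>(t, p, x). B t p x)"
    and K: "compact K"
    and lip: "\<And>t p x y. t \<in> {0..1} \<Longrightarrow> p \<in> K \<Longrightarrow> norm (B t p x - B t p y) \<le> M * norm (x - y)"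
    and M: "M > 0"
  obtains X where "continuous_on ({0..1} \<times> K) (\<lambda>(t, p). X t p)"
    "\<And>p. p \<in> K \<Longrightarrow> X 0 p = x0"
    "\<And>t p. t \<in> {0..1} \<Longrightarrow> p \<in> K \<Longrightarrow> ((\<lambda>t. X t p) has_vector_derivative B t p (X t p)) (at t within {0..1})"
proof -
  have comp: "continuous_on ({0..1} \<times> K) (\<lambda>(t, p). B t p (Y t p))"
    if "continuous_on ({0..1} \<times> K) (\<lambda>(t, p). Y t p)" for Y
    unfolding case_prod_unfold
    by (rule continuous_on_compose2[OF B[unfolded case_prod_unfold], of _ "\<lambda>q. (fst q, snd q, Y (fst q) (snd q))", simplified])
      (use that in \<open>auto intro!: continuous_intros simp: case_prod_unfold\<close>)
  have slice: "continuous_on {0..t} (\<lambda>s. Y s p)"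
    if "continuous_on ({0..1} \<times> K) (\<lambda>(t, p). Y t p)" "t \<in> {0..1}" "p \<in> K" for Y :: "real \<Rightarrow> 'p \<Rightarrow> 'a" and t p
    by (rule continuous_on_compose2[OF that(1), of _ "\<lambda>s. (s, p)", simplified])
      (use that(2,3) in \<open>auto intro!: continuous_intros\<close>)
  define T where "T Y t p = x0 + integral {0..t} (\<lambda>s. B s p (Y s p))" for Y t p
  have T_cont: "continuous_on ({0..1} \<times> K) (\<lambda>(t, p). T Y t p)"
    if "continuous_on ({0..1} \<times> K) (\<lambda>(t, p). Y t p)" for Y
    using continuous_on_indefinite_integral_param[OF comp[OF that]]
    by (auto simp: T_def case_prod_unfold intro!: continuous_intros)
  define Y where "Y n = (T ^^ n) (\<lambda>_ _. x0)" for n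
  have Y_Suc: "Y (Suc n) t p = x0 + integral {0..t} (\<lambda>s. B s p (Y n s p))" for n t p
    by (simp add: Y_def T_def)
  have Y_cont: "continuous_on ({0..1} \<times> K) (\<lambda>(t, p). Y n t p)" for n
    by (induction n) (auto simp: Y_def T_cont case_prod_unfold[symmetric])
  have "compact ({0..1::real} \<times> K)" by (intro compact_Times compact_Icc K)
  then have "bounded ((\<lambda>(t, p). Y 1 t p - Y 0 t p) ` ({0..1} \<times> K))"
    using Y_cont[of 1] Y_cont[of 0]
    by (intro compact_imp_bounded compact_continuous_image) (auto simp: case_prod_unfold intro!: continuous_intros)
  then obtain C where "\<forall>y\<in>(\<lambda>(t, p). Y 1 t p - Y 0 t p) ` ({0..1} \<times> K). norm y \<le> C"
    unfolding bounded_iff by blast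
  then have C: "norm (Y 1 t p - Y 0 t p) \<le> C" if "t \<in> {0..1}" "p \<in> K" for t p
    using that by force
  have step: "norm (Y (Suc n) t p - Y n t p) \<le> \<bar>C\<bar> * exp (2 * M * t) * (1/2)^n" if t: "t \<in> {0..1}" and p: "p \<in> K" for n t p
    using t
  proof (induction n arbitrary: t)
    case 0
    have "norm (Y 1 t p - Y 0 t p) \<le> \<bar>C\<bar> * 1" using C[OF 0 p] by simp
    also have "\<dots> \<le> \<bar>C\<bar> * exp (2 * M * t)" using 0 M by (intro mult_left_mono) auto
    finally show ?case by simp
  next
    case (Suc n)
    have int: "(\<lambda>s. B s p (Y m s p)) integrable_on {0..t}" for m
      using slice[OF comp[OF Y_cont] Suc.prems p] by (rule integrable_continuous_real)
    define E where "E s = M * (\<bar>C\<bar> * exp (2 * M * s) * (1/2)^n)" for s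
    have "((\<lambda>s. \<bar>C\<bar> * exp (2 * M * s) * (1/2)^Suc n) has_vector_derivative E s) (at s within {0..t})" for s
      unfolding has_real_derivative_iff_has_vector_derivative[symmetric] E_def
      by (auto intro!: derivative_eq_intros)
    then have E: "(E has_integral (\<bar>C\<bar> * exp (2 * M * t) * (1/2)^Suc n - \<bar>C\<bar> * exp (2 * M * 0) * (1/2)^Suc n)) {0..t}"
      using Suc.prems by (intro fundamental_theorem_of_calculus) auto
    have "norm (Y (Suc (Suc n)) t p - Y (Suc n) t p) = norm (integral {0..t} (\<lambda>s. B s p (Y (Suc n) s p) - B s p (Y n s p)))"
      unfolding Y_Suc[of "Suc n"] Y_Suc[of n t p] integral_diff[OF int int] by simp
    also have "\<dots> \<le> integral {0..t} E"
    proof (rule integral_norm_bound_integral)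
      fix s assume s: "s \<in> {0..t}"
      then have s': "s \<in> {0..1}" using Suc.prems by auto
      have "norm (B s p (Y (Suc n) s p) - B s p (Y n s p)) \<le> M * norm (Y (Suc n) s p - Y n s p)"
        by (rule lip[OF s' p])
      also have "\<dots> \<le> E s" unfolding E_def using Suc.IH[OF s'] M by (intro mult_left_mono) auto
      finally show "norm (B s p (Y (Suc n) s p) - B s p (Y n s p)) \<le> E s" .
    qed (use E in \<open>auto intro!: integrable_diff int\<close>)
    also have "\<dots> \<le> \<bar>C\<bar> * exp (2 * M * t) * (1/2)^Suc n" using integral_unique[OF E] by simp
    finally show ?case .
  qed
  define X where "X t p = x0 + (\<Sum>n. Y (Suc n) t p - Y n t p)" for t p
  have partial: "Y n t p = x0 + (\<Sum>k<n. Y (Suc k) t p - Y k t p)" for n t p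
    using sum_lessThan_telescope[of "\<lambda>k. Y k t p" n] by (simp add: Y_def)
  have "uniform_limit ({0..1} \<times> K) (\<lambda>n q. \<Sum>k<n. Y (Suc k) (fst q) (snd q) - Y k (fst q) (snd q))
      (\<lambda>q. \<Sum>n. Y (Suc n) (fst q) (snd q) - Y n (fst q) (snd q)) sequentially"
  proof (rule Weierstrass_m_test)
    fix n and q :: "real \<times> 'p" assume q: "q \<in> {0..1} \<times> K"
    then have "norm (Y (Suc n) (fst q) (snd q) - Y n (fst q) (snd q)) \<le> \<bar>C\<bar> * exp (2 * M * fst q) * (1/2)^n"
      by (intro step) auto
    also have "\<dots> \<le> \<bar>C\<bar> * exp (2 * M) * (1/2)^n"
      using q M by (intro mult_right_mono mult_left_mono) auto
    finally show "norm (Y (Suc n) (fst q) (snd q) - Y n (fst q) (snd q)) \<le> \<bar>C\<bar> * exp (2 * M) * (1/2)^n" .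
  qed (intro summable_mult summable_geometric, simp)
  then have "uniform_limit ({0..1} \<times> K) (\<lambda>n q. x0 + (\<Sum>k<n. Y (Suc k) (fst q) (snd q) - Y k (fst q) (snd q)))
      (\<lambda>q. x0 + (\<Sum>n. Y (Suc n) (fst q) (snd q) - Y n (fst q) (snd q))) sequentially"
    by (intro uniform_limit_intros)
  then have ul: "uniform_limit ({0..1} \<times> K) (\<lambda>n q. Y n (fst q) (snd q)) (\<lambda>q. X (fst q) (snd q)) sequentially"
    unfolding X_def by (simp only: partial[symmetric])
  have X_cont: "continuous_on ({0..1} \<times> K) (\<lambda>(t, p). X t p)"
    unfolding case_prod_unfold
    using Y_cont by (intro uniform_limit_theorem[OF _ ul]) (auto simp: case_prod_unfold)
  have X_eq: "X t p = x0 + integral {0..t} (\<lambda>s. B s p (X s p))" if t: "t \<in> {0..1}" and p: "p \<in> K" for t p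
  proof -
    have "uniform_limit {0..t} (\<lambda>n s. B s p (Y n s p)) (\<lambda>s. B s p (X s p)) sequentially"
    proof (rule uniform_limitI)
      fix e :: real assume "e > 0"
      then have "e / M > 0" using M by simp
      have "\<forall>\<^sub>F n in sequentially. \<forall>q\<in>{0..1} \<times> K. dist (Y n (fst q) (snd q)) (X (fst q) (snd q)) < e / M"
        using uniform_limitD[OF ul \<open>e / M > 0\<close>] .
      then show "\<forall>\<^sub>F n in sequentially. \<forall>s\<in>{0..t}. dist (B s p (Y n s p)) (B s p (X s p)) < e"
      proof eventually_elim
        case (elim n)
        show ?case
        proof
          fix s assume "s \<in> {0..t}"
          then have s: "s \<in> {0..1}" using t by auto
          have "dist (B s p (Y n s p)) (B s p (X s p)) \<le> M * norm (Y n s p - X s p)"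
            unfolding dist_norm by (rule lip[OF s p])
          also have "\<dots> < M * (e / M)"
            using elim s p M by (intro mult_strict_left_mono) (auto simp: dist_norm)
          finally show "dist (B s p (Y n s p)) (B s p (X s p)) < e" using M by simp
        qed
      qed
    qed
    then obtain I1 J1 where IJ: "\<And>n. ((\<lambda>s. B s p (Y n s p)) has_integral I1 n) {0..t}"
      "((\<lambda>s. B s p (X s p)) has_integral J1) {0..t}" "I1 \<longlonglongrightarrow> J1"
      by (rule uniform_limit_integral) (use slice[OF comp[OF Y_cont] t p] in auto)
    then have "(\<lambda>n. integral {0..t} (\<lambda>s. B s p (Y n s p))) \<longlonglongrightarrow> integral {0..t} (\<lambda>s. B s p (X s p))"
      by (simp add: integral_unique[OF IJ(1)] integral_unique[OF IJ(2)])
    then have "(\<lambda>n. Y (Suc n) t p) \<longlonglongrightarrow> x0 + integral {0..t} (\<lambda>s. B s p (X s p))"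
      unfolding Y_Suc by (intro tendsto_intros)
    moreover have "(\<lambda>n. Y n t p) \<longlonglongrightarrow> X t p"
      using tendsto_uniform_limitI[OF ul, of "(t, p)"] t p by simp
    then have "(\<lambda>n. Y (Suc n) t p) \<longlonglongrightarrow> X t p" by (rule LIMSEQ_Suc)
    ultimately show ?thesis by (rule LIMSEQ_unique[symmetric])
  qed
  show thesis
  proof
    show "continuous_on ({0..1} \<times> K) (\<lambda>(t, p). X t p)" by (rule X_cont)
    show "X 0 p = x0" if "p \<in> K" for p using X_eq[of 0 p] that by simp
    fix t :: real and p assume t: "t \<in> {0..1}" and p: "p \<in> K"
    have "((\<lambda>u. integral {0..u} (\<lambda>s. B s p (X s p))) has_vector_derivative B t p (X t p)) (at t within {0..1})"
      using slice[OF comp[OF X_cont] _ p, of 1] t by (intro integral_has_vector_derivative) auto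
    from has_vector_derivative_add[OF has_vector_derivative_const[of x0] this]
    have "((\<lambda>u. x0 + integral {0..u} (\<lambda>s. B s p (X s p))) has_vector_derivative B t p (X t p)) (at t within {0..1})"
      by simp
    then show "((\<lambda>t. X t p) has_vector_derivative B t p (X t p)) (at t within {0..1})"
      by (rule has_vector_derivative_transform[OF t, rotated]) (use X_eq p in auto)
  qed
qed

section \<open>The equation as a first-order system with continuous coefficients\<close>

lemma DI_eqI: "(u has_real_derivative d) (at t within I) \<Longrightarrow> t \<in> I \<Longrightarrow> DI u t = d"
  unfolding DI_def has_real_derivative_iff_has_vector_derivative
  by (rule vector_derivative_within_closed_interval) auto

lemma DI_works: "u differentiable (at t within I) \<Longrightarrow> (u has_real_derivative DI u t) (at t within I)"
  unfolding DI_def has_real_derivative_iff_has_vector_derivative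
  by (simp add: vector_derivative_works)

lemma has_real_derivative_cong_I:
  assumes "(f has_real_derivative d) (at t within {a..b})" "\<And>s. s \<in> {a..b} \<Longrightarrow> f s = g s" "t \<in> {a..b}"
  shows "(g has_real_derivative d) (at t within {a..b})"
  using has_field_derivative_transform_within[OF assms(1) zero_less_one assms(3)] assms(2) by blast

lemma indefinite_integral_has_real_derivative:
  assumes g: "continuous_on {a..b} g" and eq: "\<And>t. t \<in> {a..b} \<Longrightarrow> f t = c + integral {a..t} g"
    and t: "t \<in> {a..b}"
  shows "(f has_real_derivative g t) (at t within {a..b})"
proof -
  have "((\<lambda>t. integral {a..t} g) has_real_derivative g t) (at t within {a..b})"
    unfolding has_real_derivative_iff_has_vector_derivative
    by (rule integral_has_vector_derivative[OF g t])
  from DERIV_add[OF DERIV_const[of c] this]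
  have "((\<lambda>t. c + integral {a..t} g) has_real_derivative g t) (at t within {a..b})" by simp
  then show ?thesis by (rule has_real_derivative_cong_I) (use eq t in auto)
qed

lemma abs_continuous_on_C1:
  assumes der: "\<And>t. t \<in> {a..b} \<Longrightarrow> (f has_real_derivative f' t) (at t within {a..b})"
    and cont: "continuous_on {a..b} f'"
  shows "abs_continuous_on {a..b} f"
proof -
  have eq: "f a + integral {a..x} f' = f x" if x: "x \<in> {a..b}" for x
  proof -
    have "(f' has_integral (f x - f a)) {a..x}"
    proof (rule fundamental_theorem_of_calculus)
      show "a \<le> x" using x by simp
      show "(f has_vector_derivative f' t) (at t within {a..x})" if "t \<in> {a..x}" for t
        using der[of t] that x
        by (intro has_vector_derivative_within_subset[of f "f' t" t "{a..b}" "{a..x}"])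
          (auto simp: has_real_derivative_iff_has_vector_derivative)
    qed
    then show ?thesis by (simp add: integral_unique)
  qed
  have "abs_continuous_on {a..b} (\<lambda>x. f a + integral {a..x} f')"
    by (rule abs_continuous_on_bound[OF _ _ zero_less_one])
      (use abs_continuous_on_indefinite_integral[OF absolutely_integrable_continuous_real[OF cont]] in auto)
  then show ?thesis by (rule abs_continuous_on_cong[rotated]) (use eq in auto)
qed

lemma absolutely_integrable_mult_continuous:
  fixes f g :: "real \<Rightarrow> real"
  assumes f: "continuous_on {a..b} f" and g: "g absolutely_integrable_on {a..b}"
  shows "(\<lambda>x. f x * g x) absolutely_integrable_on {a..b}"
  using f g
  by (intro absolutely_integrable_bounded_measurable_product_real continuous_imp_measurable_on_sets_lebesgue
      compact_imp_bounded compact_continuous_image) auto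

lemma AE_lebesgue_on_set_iff:
  "(AE t\<in>S in lebesgue. P t) \<longleftrightarrow> (\<exists>N. negligible N \<and> (\<forall>t\<in>S - N. P t))"
proof
  assume "AE t\<in>S in lebesgue. P t"
  then obtain N where "N \<in> null_sets lebesgue" "{t. \<not> (t \<in> S \<longrightarrow> P t)} \<subseteq> N"
    by (auto simp: eventually_ae_filter)
  then show "\<exists>N. negligible N \<and> (\<forall>t\<in>S - N. P t)"
    by (intro exI[of _ N]) (auto simp: negligible_iff_null_sets)
next
  assume "\<exists>N. negligible N \<and> (\<forall>t\<in>S - N. P t)"
  then obtain N where N: "negligible N" "\<And>t. t \<in> S - N \<Longrightarrow> P t" by blast
  then have "AE t in lebesgue. t \<notin> N" by (intro AE_not_in) (simp add: negligible_iff_null_sets)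
  then show "AE t\<in>S in lebesgue. P t" by eventually_elim (use N(2) in blast)
qed

locale potential =
  fixes a :: "real \<Rightarrow> real"
  assumes a_int: "a absolutely_integrable_on I"
begin

definition A :: "real \<Rightarrow> real" where "A t = integral {0..t} a"

lemma A_0 [simp]: "A 0 = 0"
  by (simp add: A_def)

lemma A_ac: "abs_continuous_on I A"
  unfolding A_def[abs_def] by (rule abs_continuous_on_indefinite_integral[OF a_int])

lemma A_cont: "continuous_on I A"
  by (rule abs_continuous_on_imp_continuous_on[OF A_ac])

lemma A_derivative_ae:
  obtains N where "negligible N" "\<And>t. t \<in> I - N \<Longrightarrow> (A has_real_derivative a t) (at t within I)"
proof -
  have "a integrable_on I" using a_int by (simp add: absolutely_integrable_on_def)
  then show thesis using indefinite_integral_has_derivative_ae[of a 0 1] that unfolding A_def[abs_def] by metis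
qed

text \<open>
  \<open>z\<close> is the quasi-derivative of \<open>u\<close>. All derivatives are relative to \<open>I\<close>, as those of \<^const>\<open>DI\<close>.
\<close>

definition system :: "real \<Rightarrow> (real \<Rightarrow> real) \<Rightarrow> (real \<Rightarrow> real) \<Rightarrow> bool" where
  "system l u z \<longleftrightarrow> (\<forall>t\<in>I.
     (u has_real_derivative z t - A t * u t) (at t within I) \<and>
     (z has_real_derivative A t * z t - ((A t)\<^sup>2 + l) * u t) (at t within I))"

lemma system_cont: "system l u z \<Longrightarrow> continuous_on I u" "system l u z \<Longrightarrow> continuous_on I z"
  unfolding system_def by (meson DERIV_continuous continuous_on_eq_continuous_within)+

definition quasi :: "(real \<Rightarrow> real) \<Rightarrow> real \<Rightarrow> real" where
  "quasi u t = DI u t + A t * u t"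

lemma W21_derivative: "u \<in> W21 \<Longrightarrow> t \<in> I \<Longrightarrow> (u has_real_derivative DI u t) (at t within I)"
  unfolding W21_def differentiable_on_def by (auto intro: DI_works)

lemma W21_ac:
  assumes "u \<in> W21"
  shows "abs_continuous_on I u" "abs_continuous_on I (quasi u)"
proof -
  have D: "abs_continuous_on I (DI u)" using assms by (simp add: W21_def)
  show u: "abs_continuous_on I u"
    using W21_derivative[OF assms] abs_continuous_on_imp_continuous_on[OF D] by (rule abs_continuous_on_C1)
  show "abs_continuous_on I (quasi u)"
    unfolding quasi_def[abs_def] by (intro abs_continuous_on_add abs_continuous_on_mult D u A_ac)
qed

text \<open>
  In \<open>z' = u'' + a u + A u'\<close> the equation replaces \<open>u''\<close> by \<open>\<sigma> - (a + l) u\<close>, and the terms with \<open>a\<close>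
  cancel. The result is stated in integrated form because \<open>\<sigma>\<close> is merely integrable.
\<close>

lemma W21_solves_imp_system:
  assumes u: "u \<in> W21" and sol: "solves a l \<sigma> u"
  shows "t \<in> I \<Longrightarrow> (u has_real_derivative quasi u t - A t * u t) (at t within I)"
    and "(\<lambda>s. A s * quasi u s - ((A s)\<^sup>2 + l) * u s + \<sigma> s) absolutely_integrable_on I" (is ?int)
    and "t \<in> I \<Longrightarrow> quasi u t = quasi u 0 + integral {0..t} (\<lambda>s. A s * quasi u s - ((A s)\<^sup>2 + l) * u s + \<sigma> s)"
proof -
  show "t \<in> I \<Longrightarrow> (u has_real_derivative quasi u t - A t * u t) (at t within I)"
    using W21_derivative[OF u] by (simp add: quasi_def)
  have D: "abs_continuous_on I (DI u)" using u by (simp add: W21_def)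
  obtain N1 where N1: "negligible N1" "\<And>t. t \<in> I - N1 \<Longrightarrow> DI u differentiable (at t within I)"
    using abs_continuous_on_differentiable_ae[OF D] by blast
  obtain N2 where N2: "negligible N2" "\<And>t. t \<in> I - N2 \<Longrightarrow> (A has_real_derivative a t) (at t within I)"
    using A_derivative_ae by blast
  obtain N3 where N3: "negligible N3" "\<And>t. t \<in> I - N3 \<Longrightarrow> Lop a l u t = \<sigma> t"
    using sol unfolding solves_def AE_lebesgue_on_set_iff by blast
  let ?N = "N1 \<union> N2 \<union> N3"
  have N: "negligible ?N" using N1(1) N2(1) N3(1) by auto
  have der: "(quasi u has_real_derivative A t * quasi u t - ((A t)\<^sup>2 + l) * u t + \<sigma> t) (at t within I)"
    if t: "t \<in> I - ?N" for t
  proof -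
    have "(DI u has_real_derivative DI (DI u) t) (at t within I)"
      using N1(2)[of t] t by (intro DI_works) auto
    moreover have "(A has_real_derivative a t) (at t within I)" using N2(2) t by auto
    moreover have "(u has_real_derivative DI u t) (at t within I)" using W21_derivative[OF u] t by auto
    ultimately have "(quasi u has_real_derivative DI (DI u) t + (a t * u t + DI u t * A t)) (at t within I)"
      unfolding quasi_def[abs_def] by (intro DERIV_add DERIV_mult')
        (auto intro!: derivative_eq_intros)
    moreover have "DI (DI u) t + (a t + l) * u t = \<sigma> t" using N3(2)[of t] t by (auto simp: Lop_def)
    then have "DI (DI u) t = \<sigma> t - (a t + l) * u t" by linarith
    then have "DI (DI u) t + (a t * u t + DI u t * A t) = A t * quasi u t - ((A t)\<^sup>2 + l) * u t + \<sigma> t"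
      by (simp add: quasi_def algebra_simps power2_eq_square)
    ultimately show ?thesis by simp
  qed
  note ftc = abs_continuous_on_ftc[OF W21_ac(2)[OF u] N der]
  show ?int by (rule ftc(1))
  show "t \<in> I \<Longrightarrow> quasi u t = quasi u 0 + integral {0..t} (\<lambda>s. A s * quasi u s - ((A s)\<^sup>2 + l) * u s + \<sigma> s)"
    by (rule ftc(2))
qed

text \<open>
  The converse passage: here \<open>u' = z - A u\<close> is absolutely continuous as a product and difference of such
  functions, and \<open>u''\<close> is computed by the product rule where \<open>A\<close> and \<open>z\<close> are differentiable.
\<close>

lemma system_imp_W21_solves:
  assumes u: "\<And>t. t \<in> I \<Longrightarrow> (u has_real_derivative z t - A t * u t) (at t within I)"
    and z: "abs_continuous_on I z"
    and N: "negligible N"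
    and z': "\<And>t. t \<in> I - N \<Longrightarrow> (z has_real_derivative A t * z t - ((A t)\<^sup>2 + l) * u t + \<sigma> t) (at t within I)"
  shows "u \<in> W21" "solves a l \<sigma> u" "\<And>t. t \<in> I \<Longrightarrow> DI u t = z t - A t * u t"
proof -
  show DI: "DI u t = z t - A t * u t" if "t \<in> I" for t
    using u[OF that] that by (rule DI_eqI)
  have "continuous_on I u"
    using u by (meson DERIV_continuous continuous_on_eq_continuous_within)
  then have "abs_continuous_on I u"
    using abs_continuous_on_imp_continuous_on[OF z] A_cont
    by (intro abs_continuous_on_C1[OF u]) (auto intro!: continuous_intros)
  then have "abs_continuous_on I (\<lambda>t. z t - A t * u t)"
    by (intro abs_continuous_on_diff abs_continuous_on_mult z A_ac)
  then have "abs_continuous_on I (DI u)" by (rule abs_continuous_on_cong[rotated]) (simp add: DI)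
  moreover have "u differentiable_on I"
    using u unfolding differentiable_on_def by (meson real_differentiable_def)
  ultimately show "u \<in> W21" by (simp add: W21_def)
  obtain N2 where N2: "negligible N2" "\<And>t. t \<in> I - N2 \<Longrightarrow> (A has_real_derivative a t) (at t within I)"
    using A_derivative_ae by blast
  have "Lop a l u t = \<sigma> t" if t: "t \<in> I - (N \<union> N2)" for t
  proof -
    have tI: "t \<in> I" using t by simp
    have "((\<lambda>t. z t - A t * u t) has_real_derivative
        (A t * z t - ((A t)\<^sup>2 + l) * u t + \<sigma> t) - (a t * u t + (z t - A t * u t) * A t)) (at t within I)"
      using z'[of t] N2(2)[of t] u[of t] t by (auto intro!: derivative_eq_intros)
    then have "(DI u has_real_derivative
        (A t * z t - ((A t)\<^sup>2 + l) * u t + \<sigma> t) - (a t * u t + (z t - A t * u t) * A t)) (at t within I)"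
      by (rule has_real_derivative_cong_I) (use DI tI in auto)
    from DI_eqI[OF this tI] show ?thesis by (simp add: Lop_def algebra_simps power2_eq_square)
  qed
  then show "solves a l \<sigma> u"
    unfolding solves_def AE_lebesgue_on_set_iff using N N2(1) by (intro exI[of _ "N \<union> N2"]) auto
qed

lemma system_solution:
  assumes "system l u z"
  shows "u \<in> W21" "solves a l (\<lambda>_. 0) u" "\<And>t. t \<in> I \<Longrightarrow> DI u t = z t - A t * u t"
proof -
  have z: "abs_continuous_on I z"
    using assms system_cont[OF assms] A_cont
    by (intro abs_continuous_on_C1[where f' = "\<lambda>t. A t * z t - ((A t)\<^sup>2 + l) * u t"])
      (auto simp: system_def intro!: continuous_intros)
  note * = system_imp_W21_solves[of u z "{}" l "\<lambda>_. 0", OF _ z]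
  show "u \<in> W21" "solves a l (\<lambda>_. 0) u" "\<And>t. t \<in> I \<Longrightarrow> DI u t = z t - A t * u t"
    using * assms by (auto simp: system_def)
qed

lemma system_linear:
  assumes "system l u z" "system l v w"
  shows "system l (\<lambda>t. c * u t + d * v t) (\<lambda>t. c * z t + d * w t)"
  unfolding system_def
proof (intro ballI conjI)
  fix t assume "t \<in> I"
  then have *: "(u has_real_derivative z t - A t * u t) (at t within I)"
    "(z has_real_derivative A t * z t - ((A t)\<^sup>2 + l) * u t) (at t within I)"
    "(v has_real_derivative w t - A t * v t) (at t within I)"
    "(w has_real_derivative A t * w t - ((A t)\<^sup>2 + l) * v t) (at t within I)"
    using assms by (auto simp: system_def)
  show "((\<lambda>t. c * u t + d * v t) has_real_derivative c * z t + d * w t - A t * (c * u t + d * v t)) (at t within I)"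
    by (rule DERIV_cong[OF DERIV_add[OF DERIV_cmult[OF *(1)] DERIV_cmult[OF *(3)]]]) (simp add: algebra_simps)
  show "((\<lambda>t. c * z t + d * w t) has_real_derivative
      A t * (c * z t + d * w t) - ((A t)\<^sup>2 + l) * (c * u t + d * v t)) (at t within I)"
    by (rule DERIV_cong[OF DERIV_add[OF DERIV_cmult[OF *(2)] DERIV_cmult[OF *(4)]]]) (simp add: algebra_simps)
qed

lemma system_wronskian:
  assumes "system l u z" "system l v w" "t \<in> I"
  shows "u t * w t - v t * z t = u 0 * w 0 - v 0 * z 0"
proof -
  have "((\<lambda>t. u t * w t - v t * z t) has_real_derivative 0) (at t within I)" if "t \<in> I" for t
  proof -
    have *: "(u has_real_derivative z t - A t * u t) (at t within I)"
      "(z has_real_derivative A t * z t - ((A t)\<^sup>2 + l) * u t) (at t within I)"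
      "(v has_real_derivative w t - A t * v t) (at t within I)"
      "(w has_real_derivative A t * w t - ((A t)\<^sup>2 + l) * v t) (at t within I)"
      using assms that by (auto simp: system_def)
    show ?thesis
      by (rule DERIV_cong[OF DERIV_diff[OF DERIV_mult'[OF *(1) *(4)] DERIV_mult'[OF *(3) *(2)]]])
        (simp add: algebra_simps)
  qed
  then have "\<exists>c. \<forall>t\<in>I. u t * w t - v t * z t = c"
    by (intro has_field_derivative_zero_constant) auto
  then show ?thesis using assms(3) by (metis atLeastAtMost_iff order_refl zero_le_one)
qed

text \<open>
  In the difference of the integrated equations \<open>\<sigma>\<close> cancels and the integrand becomes continuous, so the
  equation holds classically. Uniqueness questions are thereby reduced to the homogeneous system.
\<close>

lemma solutions_diff_system:
  assumes u: "u \<in> W21" "solves a l \<sigma> u" and v: "v \<in> W21" "solves a l \<sigma> v"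
  shows "system l (\<lambda>t. u t - v t) (\<lambda>t. quasi u t - quasi v t)"
proof -
  define g where "g s = A s * (quasi u s - quasi v s) - ((A s)\<^sup>2 + l) * (u s - v s)" for s
  have g: "continuous_on I g"
    unfolding g_def
    by (intro continuous_intros A_cont abs_continuous_on_imp_continuous_on[OF W21_ac(1)]
        abs_continuous_on_imp_continuous_on[OF W21_ac(2)] u v)
  have eq: "quasi u t - quasi v t = (quasi u 0 - quasi v 0) + integral {0..t} g" if t: "t \<in> I" for t
  proof -
    let ?f = "\<lambda>u s. A s * quasi u s - ((A s)\<^sup>2 + l) * u s + \<sigma> s"
    have sub: "{0..t} \<subseteq> I" using t by auto
    have "integral {0..t} g = integral {0..t} (\<lambda>s. ?f u s - ?f v s)"
      by (rule integral_cong) (simp add: g_def algebra_simps)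
    also have "\<dots> = integral {0..t} (?f u) - integral {0..t} (?f v)"
      using W21_solves_imp_system(2)[OF u] W21_solves_imp_system(2)[OF v]
      by (intro integral_diff) (auto simp: absolutely_integrable_on_def intro: integrable_on_subinterval[OF _ sub])
    finally show ?thesis
      using W21_solves_imp_system(3)[OF u t] W21_solves_imp_system(3)[OF v t] by linarith
  qed
  have "((\<lambda>t. quasi u t - quasi v t) has_real_derivative g t) (at t within I)" if "t \<in> I" for t
    using g eq that by (rule indefinite_integral_has_real_derivative)
  moreover have "((\<lambda>t. u t - v t) has_real_derivative (quasi u t - quasi v t) - A t * (u t - v t)) (at t within I)"
    if "t \<in> I" for t
    using DERIV_diff[OF W21_solves_imp_system(1)[OF u that] W21_solves_imp_system(1)[OF v that]]
    by (simp add: algebra_simps)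
  ultimately show ?thesis by (simp add: system_def g_def)
qed

lemma system_exists_param:
  obtains U Z where "continuous_on (I \<times> {c..d}) (\<lambda>(t, l). U t l :: real)"
    "\<And>l. l \<in> {c..d} \<Longrightarrow> system l (\<lambda>t. U t l) (\<lambda>t. Z t l)"
    "\<And>l. l \<in> {c..d} \<Longrightarrow> U 0 l = u0" "\<And>l. l \<in> {c..d} \<Longrightarrow> Z 0 l = (z0 :: real)"
proof -
  have "bounded (A ` I)" using A_cont by (intro compact_imp_bounded compact_continuous_image) auto
  then obtain C where C: "\<And>t. t \<in> I \<Longrightarrow> \<bar>A t\<bar> \<le> C"
    unfolding bounded_iff by (metis imageI real_norm_def)
  have "C \<ge> 0" using C[of 0] by auto
  define R where "R = \<bar>c\<bar> + \<bar>d\<bar>"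
  define B :: "real \<Rightarrow> real \<Rightarrow> real \<times> real \<Rightarrow> real \<times> real" where
    "B t l x = (snd x - A t * fst x, A t * snd x - ((A t)\<^sup>2 + l) * fst x)" for t l x
  define M where "M = 1 + 2 * C + C\<^sup>2 + R"
  have B_cont: "continuous_on (I \<times> {c..d} \<times> UNIV) (\<lambda>(t, l, x). B t l x)"
    unfolding B_def case_prod_unfold
    by (intro continuous_intros continuous_on_compose2[OF A_cont]) auto
  have lip: "norm (B t l x - B t l y) \<le> M * norm (x - y)" if t: "t \<in> I" and l: "l \<in> {c..d}" for t l x y
  proof -
    define n where "n = norm (x - y)"
    define p q where "p = fst x - fst y" and "q = snd x - snd y"
    have pq: "\<bar>p\<bar> \<le> n" "\<bar>q\<bar> \<le> n"
      using norm_fst_le[of "fst (x - y)" "snd (x - y)"] norm_snd_le[of "snd (x - y)" "fst (x - y)"]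
      unfolding prod.collapse by (simp_all add: n_def p_def q_def)
    have "B t l x - B t l y = (q - A t * p, A t * q - ((A t)\<^sup>2 + l) * p)"
      by (simp add: B_def p_def q_def algebra_simps)
    then have "norm (B t l x - B t l y) \<le> \<bar>q - A t * p\<bar> + \<bar>A t * q - ((A t)\<^sup>2 + l) * p\<bar>"
      using norm_Pair_le[of "q - A t * p" "A t * q - ((A t)\<^sup>2 + l) * p"] by simp
    also have "\<dots> \<le> (\<bar>q\<bar> + \<bar>A t\<bar> * \<bar>p\<bar>) + (\<bar>A t\<bar> * \<bar>q\<bar> + \<bar>(A t)\<^sup>2 + l\<bar> * \<bar>p\<bar>)"
      by (intro add_mono order_trans[OF abs_triangle_ineq4]) (simp_all add: abs_mult)
    also have "\<dots> \<le> (n + C * n) + (C * n + (C\<^sup>2 + R) * n)"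
    proof -
      have "\<bar>(A t)\<^sup>2 + l\<bar> \<le> C\<^sup>2 + R"
      proof -
        have "(A t)\<^sup>2 \<le> C\<^sup>2" using C[OF t] by (metis abs_ge_zero power2_abs power_mono)
        moreover have "\<bar>l\<bar> \<le> R" using l by (auto simp: R_def)
        moreover have "\<bar>(A t)\<^sup>2\<bar> = (A t)\<^sup>2" by simp
        ultimately show ?thesis using abs_triangle_ineq[of "(A t)\<^sup>2" l] by linarith
      qed
      then show ?thesis using pq C[OF t] \<open>C \<ge> 0\<close> by (intro add_mono mult_mono) (auto simp: R_def)
    qed
    also have "\<dots> = M * n" by (simp add: M_def algebra_simps)
    finally show ?thesis by (simp add: n_def)
  qed
  have "M > 0" using \<open>C \<ge> 0\<close> by (simp add: M_def R_def add_pos_nonneg)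
  obtain X where X: "continuous_on (I \<times> {c..d}) (\<lambda>(t, l). X t l)"
    "\<And>l. l \<in> {c..d} \<Longrightarrow> X 0 l = (u0, z0)"
    "\<And>t l. t \<in> I \<Longrightarrow> l \<in> {c..d} \<Longrightarrow> ((\<lambda>t. X t l) has_vector_derivative B t l (X t l)) (at t within I)"
    using picard_param[OF B_cont compact_Icc lip \<open>M > 0\<close>, of "(u0, z0)"] by blast
  show thesis
  proof
    show "continuous_on (I \<times> {c..d}) (\<lambda>(t, l). fst (X t l))"
      using X(1) by (auto simp: case_prod_unfold intro: continuous_on_fst)
    fix l assume l: "l \<in> {c..d}"
    show "fst (X 0 l) = u0" "snd (X 0 l) = z0" using X(2)[OF l] by simp_all
    show "system l (\<lambda>t. fst (X t l)) (\<lambda>t. snd (X t l))"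
      unfolding system_def has_real_derivative_iff_has_vector_derivative
      using bounded_linear.has_vector_derivative[OF bounded_linear_fst X(3)[OF _ l]]
        bounded_linear.has_vector_derivative[OF bounded_linear_snd X(3)[OF _ l]]
      by (simp add: B_def)
  qed
qed

corollary system_exists:
  obtains u z where "system l u z" "u 0 = u0" "z 0 = z0"
proof -
  obtain U Z where "continuous_on (I \<times> {l..l}) (\<lambda>(t, l). U t l :: real)"
    "\<And>l'. l' \<in> {l..l} \<Longrightarrow> system l' (\<lambda>t. U t l') (\<lambda>t. Z t l')"
    "\<And>l'. l' \<in> {l..l} \<Longrightarrow> U 0 l' = u0" "\<And>l'. l' \<in> {l..l} \<Longrightarrow> Z 0 l' = z0"
    by (rule system_exists_param[of l l u0 z0]) blast
  then show thesis using that[of "\<lambda>t. U t l" "\<lambda>t. Z t l"] by auto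
qed

end

section \<open>Green kernels built from two solutions\<close>

text \<open>
  For fixed \<open>t\<close>, apply both kernels to the function \<open>\<sigma>(s) = G t s - H t s\<close> with the same \<open>t\<close>. The two
  solutions agree at \<open>t\<close>, which says \<open>\<integral> \<sigma>\<^sup>2 = 0\<close>.
\<close>

lemma green_eq_on_square:
  assumes G: "is_green X a l G"
    and uniq: "\<And>\<sigma> u v. u \<in> X \<Longrightarrow> v \<in> X \<Longrightarrow> solves a l \<sigma> u \<Longrightarrow> solves a l \<sigma> v \<Longrightarrow> (\<forall>t\<in>I. u t = v t)"
    and t: "t \<in> I" and s: "s \<in> I"
  shows "green X a l t s = G t s"
proof -
  let ?H = "green X a l"
  have H: "is_green X a l ?H" unfolding green_def using G by (rule someI[of "is_green X a l"])
  have slice: "continuous_on I (K t)" if "is_green X a l K" for K :: "real \<Rightarrow> real \<Rightarrow> real"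
  proof -
    have "continuous_on (I \<times> I) (\<lambda>(t, s). K t s)" using that by (simp add: is_green_def)
    moreover have "continuous_on I (\<lambda>s. (t, s))" by (intro continuous_on_Pair continuous_on_const continuous_on_id)
    moreover have "(\<lambda>s. (t, s)) ` I \<subseteq> I \<times> I" using t by auto
    ultimately show ?thesis
      using continuous_on_compose2[of "I \<times> I" "\<lambda>(t, s). K t s" I "\<lambda>s. (t, s)"] by auto
  qed
  define \<sigma> where "\<sigma> s = G t s - ?H t s" for s
  have \<sigma>_cont: "continuous_on I \<sigma>" unfolding \<sigma>_def by (intro continuous_intros slice G H)
  have \<sigma>: "\<sigma> absolutely_integrable_on I" by (rule absolutely_integrable_continuous_real[OF \<sigma>_cont])
  have "\<forall>t\<in>I. (LINT s:I|lebesgue. G t s * \<sigma> s) = (LINT s:I|lebesgue. ?H t s * \<sigma> s)"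
    by (rule uniq) (use G H \<sigma> in \<open>auto simp: is_green_def\<close>)
  then have "(LINT s:I|lebesgue. G t s * \<sigma> s) = (LINT s:I|lebesgue. ?H t s * \<sigma> s)" using t by (rule bspec)
  moreover have Lint: "(LINT s:I|lebesgue. K t s * \<sigma> s) = integral I (\<lambda>s. K t s * \<sigma> s)"
    if "is_green X a l K" for K
    by (intro set_lebesgue_integral_eq_integral(2) absolutely_integrable_continuous_real
        continuous_on_mult slice that \<sigma>_cont)
  ultimately have eq: "integral I (\<lambda>s. G t s * \<sigma> s) = integral I (\<lambda>s. ?H t s * \<sigma> s)"
    by (simp only: Lint[OF G] Lint[OF H])
  have "integral I (\<lambda>s. (\<sigma> s)\<^sup>2) = integral I (\<lambda>s. G t s * \<sigma> s - ?H t s * \<sigma> s)"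
    by (rule integral_cong) (simp add: \<sigma>_def power2_eq_square algebra_simps)
  also have "\<dots> = 0"
    using eq integral_diff[OF integrable_continuous_real[OF continuous_on_mult[OF slice[OF G] \<sigma>_cont]]
        integrable_continuous_real[OF continuous_on_mult[OF slice[OF H] \<sigma>_cont]]] by simp
  finally have "integral I (\<lambda>s. (\<sigma> s)\<^sup>2) = 0" .
  moreover have "continuous_on I (\<lambda>s. (\<sigma> s)\<^sup>2)" using \<sigma>_cont by (intro continuous_intros)
  ultimately have "(\<sigma> s)\<^sup>2 = 0"
    using integral_eq_0_iff[of 0 1 "\<lambda>s. (\<sigma> s)\<^sup>2"] s by auto
  then show ?thesis by (simp add: \<sigma>_def)
qed

context potential
begin

text \<open>
  Variation of constants: \<open>w U = g \<integral>\<^sub>0\<^sup>t f \<sigma> + f \<integral>\<^sub>t\<^sup>1 g \<sigma>\<close>, and the quasi-derivative \<open>Z\<close> of \<open>U\<close> has the same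
  form with \<open>zf\<close>, \<open>zg\<close> in place of \<open>f\<close>, \<open>g\<close> outside the integrals. The contributions of \<open>\<sigma>\<close> cancel in \<open>U'\<close>
  and add up to \<open>\<sigma>\<close> in \<open>Z'\<close> by the Wronskian. At the end points one of the two integrals
  vanishes, so \<open>U\<close> satisfies there the homogeneous boundary conditions satisfied by \<open>f\<close> at \<open>0\<close> and \<open>g\<close> at \<open>1\<close>.
\<close>

lemma green_kernel_solves:
  assumes f: "system l f zf" and g: "system l g zg"
    and w: "w = f 0 * zg 0 - g 0 * zf 0" "w \<noteq> 0"
    and \<sigma>: "\<sigma> absolutely_integrable_on I"
  defines "U \<equiv> \<lambda>t. LINT s:I|lebesgue. f (min t s) * g (max t s) / w * \<sigma> s"
  shows "U \<in> W21" "solves a l \<sigma> U"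
    "\<exists>c. U 0 = f 0 * c \<and> DI U 0 = zf 0 * c" "\<exists>d. U 1 = g 1 * d"
proof -
  note fc = system_cont[OF f] and gc = system_cont[OF g]
  have f\<sigma>: "(\<lambda>s. f s * \<sigma> s) absolutely_integrable_on I" and g\<sigma>: "(\<lambda>s. g s * \<sigma> s) absolutely_integrable_on I"
    by (intro absolutely_integrable_mult_continuous fc gc \<sigma>)+
  have f\<sigma>i: "(\<lambda>s. f s * \<sigma> s) integrable_on I" and g\<sigma>i: "(\<lambda>s. g s * \<sigma> s) integrable_on I"
    using f\<sigma> g\<sigma> by (auto simp: absolutely_integrable_on_def)
  define F where "F t = integral {0..t} (\<lambda>s. f s * \<sigma> s)" for t
  define H where "H t = integral I (\<lambda>s. g s * \<sigma> s) - integral {0..t} (\<lambda>s. g s * \<sigma> s)" for t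
  define Z where "Z t = (zg t * F t + zf t * H t) / w" for t
  have U_eq: "U t = (g t * F t + f t * H t) / w" if t: "t \<in> I" for t
  proof -
    let ?k = "\<lambda>s. f (min t s) * g (max t s) / w * \<sigma> s"
    have "continuous_on I (\<lambda>s. f (min t s) * g (max t s) / w)"
      using t w(2)
      by (intro continuous_intros continuous_on_compose2[OF fc(1)] continuous_on_compose2[OF gc(1)]) auto
    then have k: "?k absolutely_integrable_on I" by (rule absolutely_integrable_mult_continuous[OF _ \<sigma>])
    then have ki: "?k integrable_on I" by (simp add: absolutely_integrable_on_def)
    have "U t = integral I ?k" unfolding U_def by (rule set_lebesgue_integral_eq_integral(2)[OF k])
    also have "\<dots> = integral {0..t} ?k + integral {t..1} ?k"
      using t ki by (intro Henstock_Kurzweil_Integration.integral_combine[symmetric]) auto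
    also have "integral {0..t} ?k = integral {0..t} (\<lambda>s. g t / w * (f s * \<sigma> s))"
      by (rule integral_cong) (auto simp: min_def max_def)
    also have "\<dots> = g t / w * F t" by (simp add: F_def)
    also have "integral {t..1} ?k = integral {t..1} (\<lambda>s. f t / w * (g s * \<sigma> s))"
      by (rule integral_cong) (auto simp: min_def max_def)
    also have "\<dots> = f t / w * integral {t..1} (\<lambda>s. g s * \<sigma> s)" by simp
    also have "integral {t..1} (\<lambda>s. g s * \<sigma> s) = H t"
      using Henstock_Kurzweil_Integration.integral_combine[OF _ _ g\<sigma>i, of t] t by (simp add: H_def)
    finally show ?thesis by (simp add: add_divide_distrib)
  qed
  have F_ac: "abs_continuous_on I F"
    unfolding F_def[abs_def] by (rule abs_continuous_on_indefinite_integral[OF f\<sigma>])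
  have H_ac: "abs_continuous_on I H"
    by (rule abs_continuous_on_bound[OF abs_continuous_on_indefinite_integral[OF g\<sigma>] F_ac zero_less_one])
      (simp add: H_def)
  have ac: "abs_continuous_on I f" "abs_continuous_on I g" "abs_continuous_on I zf" "abs_continuous_on I zg"
    using f g fc gc A_cont
    by (auto simp: system_def intro!: continuous_intros
        intro: abs_continuous_on_C1[where f' = "\<lambda>t. zf t - A t * f t"]
          abs_continuous_on_C1[where f' = "\<lambda>t. zg t - A t * g t"]
          abs_continuous_on_C1[where f' = "\<lambda>t. A t * zf t - ((A t)\<^sup>2 + l) * f t"]
          abs_continuous_on_C1[where f' = "\<lambda>t. A t * zg t - ((A t)\<^sup>2 + l) * g t"])
  have scale: "abs_continuous_on I (\<lambda>t. h t / w)" if "abs_continuous_on I h" for h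
  proof (rule abs_continuous_on_bound[OF that that, of "1 / \<bar>w\<bar>"])
    fix x y
    have "\<bar>h y / w - h x / w\<bar> = 1 / \<bar>w\<bar> * \<bar>h y - h x\<bar>"
      by (simp add: diff_divide_distrib[symmetric])
    then show "\<bar>h y / w - h x / w\<bar> \<le> 1 / \<bar>w\<bar> * (\<bar>h y - h x\<bar> + \<bar>h y - h x\<bar>)"
      by (simp add: divide_right_mono)
  qed (use w in auto)
  have Z_ac: "abs_continuous_on I Z"
    unfolding Z_def[abs_def] by (intro scale abs_continuous_on_add abs_continuous_on_mult ac F_ac H_ac)
  have "abs_continuous_on I (\<lambda>t. (g t * F t + f t * H t) / w)"
    by (intro scale abs_continuous_on_add abs_continuous_on_mult ac F_ac H_ac)
  then have U_ac: "abs_continuous_on I U" by (rule abs_continuous_on_cong[rotated]) (simp add: U_eq)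
  obtain N1 where N1: "negligible N1" "\<And>t. t \<in> I - N1 \<Longrightarrow> (F has_real_derivative f t * \<sigma> t) (at t within I)"
    using indefinite_integral_has_derivative_ae[OF f\<sigma>i] unfolding F_def[abs_def] by blast
  obtain N2 where N2: "negligible N2"
    "\<And>t. t \<in> I - N2 \<Longrightarrow> ((\<lambda>t. integral {0..t} (\<lambda>s. g s * \<sigma> s)) has_real_derivative g t * \<sigma> t) (at t within I)"
    using indefinite_integral_has_derivative_ae[OF g\<sigma>i] by blast
  have N: "negligible (N1 \<union> N2)" using N1 N2 by auto
  have F': "(F has_real_derivative f t * \<sigma> t) (at t within I)" if "t \<in> I - (N1 \<union> N2)" for t
    using N1 that by auto
  have H': "(H has_real_derivative - (g t * \<sigma> t)) (at t within I)" if "t \<in> I - (N1 \<union> N2)" for t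
  proof -
    have "t \<in> I - N2" using that by auto
    from DERIV_diff[OF DERIV_const N2(2)[OF this]] show ?thesis
      unfolding H_def[abs_def] by simp
  qed
  have sys: "(f has_real_derivative zf t - A t * f t) (at t within I)"
      "(zf has_real_derivative A t * zf t - ((A t)\<^sup>2 + l) * f t) (at t within I)"
      "(g has_real_derivative zg t - A t * g t) (at t within I)"
      "(zg has_real_derivative A t * zg t - ((A t)\<^sup>2 + l) * g t) (at t within I)" if "t \<in> I" for t
    using f g that by (auto simp: system_def)
  have U': "(U has_real_derivative Z t - A t * U t) (at t within I)" if t: "t \<in> I - (N1 \<union> N2)" for t
  proof -
    have tI: "t \<in> I" using t by auto
    have "((\<lambda>t. (g t * F t + f t * H t) / w) has_real_derivative Z t - A t * U t) (at t within I)"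
      by (rule DERIV_cong[OF DERIV_cdivide[OF DERIV_add[OF DERIV_mult'[OF sys(3)[OF tI] F'[OF t]] DERIV_mult'[OF sys(1)[OF tI] H'[OF t]]]]])
        (simp add: Z_def U_eq[OF tI] field_simps w(2))
    then show ?thesis by (rule has_real_derivative_cong_I) (use U_eq tI in auto)
  qed
  have Z': "(Z has_real_derivative A t * Z t - ((A t)\<^sup>2 + l) * U t + \<sigma> t) (at t within I)" if t: "t \<in> I - (N1 \<union> N2)" for t
  proof -
    have tI: "t \<in> I" using t by auto
    have wt: "w = f t * zg t - g t * zf t" using system_wronskian[OF f g tI] w(1) by simp
    have e1: "((A t * zg t - ((A t)\<^sup>2 + l) * g t) * F t + (A t * zf t - ((A t)\<^sup>2 + l) * f t) * H t + w * \<sigma> t) / w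
        = A t * Z t - ((A t)\<^sup>2 + l) * U t + \<sigma> t"
      using w(2) by (simp add: Z_def U_eq[OF tI] field_simps)
    have e2: "(zg t * (f t * \<sigma> t) + (A t * zg t - ((A t)\<^sup>2 + l) * g t) * F t) +
          (zf t * - (g t * \<sigma> t) + (A t * zf t - ((A t)\<^sup>2 + l) * f t) * H t)
        = (A t * zg t - ((A t)\<^sup>2 + l) * g t) * F t + (A t * zf t - ((A t)\<^sup>2 + l) * f t) * H t + w * \<sigma> t"
      unfolding wt by (simp add: algebra_simps)
    have "((\<lambda>t. (zg t * F t + zf t * H t) / w) has_real_derivative
        A t * Z t - ((A t)\<^sup>2 + l) * U t + \<sigma> t) (at t within I)"
      by (rule DERIV_cong[OF DERIV_cdivide[OF DERIV_add[OF DERIV_mult'[OF sys(4)[OF tI] F'[OF t]] DERIV_mult'[OF sys(2)[OF tI] H'[OF t]]]]])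
        (simp only: e2 e1)
    then show ?thesis by (rule has_real_derivative_cong_I) (use tI in \<open>auto simp: Z_def\<close>)
  qed
  \<comment> \<open>The two integrals are differentiable only almost everywhere, but the derivative of \<open>U\<close> found there is
    continuous, so \<open>U\<close> is its integral and hence differentiable at every point.\<close>
  have cont: "continuous_on I (\<lambda>t. Z t - A t * U t)"
    by (intro continuous_intros abs_continuous_on_imp_continuous_on Z_ac U_ac A_ac)
  have U_der: "(U has_real_derivative Z t - A t * U t) (at t within I)" if "t \<in> I" for t
    using cont abs_continuous_on_ftc(2)[OF U_ac N U'] that by (rule indefinite_integral_has_real_derivative)
  show "U \<in> W21" "solves a l \<sigma> U"
    using system_imp_W21_solves(1,2)[OF U_der Z_ac N Z'] by blast+
  have "DI U 0 = Z 0" using system_imp_W21_solves(3)[OF U_der Z_ac N Z', of 0] by simp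
  then show "\<exists>c. U 0 = f 0 * c \<and> DI U 0 = zf 0 * c"
    by (intro exI[of _ "H 0 / w"]) (simp add: U_eq Z_def F_def)
  show "\<exists>d. U 1 = g 1 * d"
    by (intro exI[of _ "F 1 / w"]) (simp add: U_eq H_def)
qed

lemma zero_solves: "(\<lambda>_. 0) \<in> W21" "solves a l (\<lambda>_. 0) (\<lambda>_. 0)" "DI (\<lambda>_. 0) 0 = 0"
proof -
  have "system l (\<lambda>_. 0) (\<lambda>_. 0)" by (simp add: system_def)
  from system_solution[OF this] show "(\<lambda>_. 0) \<in> W21" "solves a l (\<lambda>_. 0) (\<lambda>_. 0)" "DI (\<lambda>_. 0) 0 = 0"
    by auto
qed

text \<open>
  Both boundary problems fit this form: the space \<open>X\<close> is described by the boundary data of \<open>f\<close> at \<open>0\<close> and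
  of \<open>g\<close> at \<open>1\<close>, up to factors.
\<close>

lemma green_kernel:
  assumes f: "system l f zf" and g: "system l g zg"
    and w: "w = f 0 * zg 0 - g 0 * zf 0" "w \<noteq> 0"
    and X: "\<And>u c d. u \<in> W21 \<Longrightarrow> u 0 = f 0 * c \<Longrightarrow> DI u 0 = zf 0 * c \<Longrightarrow> u 1 = g 1 * d \<Longrightarrow> u \<in> X"
    and uniq: "\<And>\<sigma> u v. u \<in> X \<Longrightarrow> v \<in> X \<Longrightarrow> solves a l \<sigma> u \<Longrightarrow> solves a l \<sigma> v \<Longrightarrow> (\<forall>t\<in>I. u t = v t)"
    and ts: "t \<in> I" "s \<in> I"
  shows "green X a l t s = f (min t s) * g (max t s) / w"
proof (rule green_eq_on_square[OF _ uniq ts])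
  have "(\<lambda>_. 0) \<in> X" using zero_solves(1,3) by (intro X[of _ 0 0]) auto
  then have "nonresonant X a l"
    unfolding nonresonant_def using uniq zero_solves(2) by blast
  moreover have "continuous_on (I \<times> I) (\<lambda>(t, s). f (min t s) * g (max t s) / w)"
    unfolding case_prod_unfold using w(2)
    by (intro continuous_intros continuous_on_compose2[OF system_cont(1)[OF f]]
        continuous_on_compose2[OF system_cont(1)[OF g]]) auto
  moreover have "(\<lambda>t. LINT s:I|lebesgue. f (min t s) * g (max t s) / w * \<sigma> s) \<in> X"
    "solves a l \<sigma> (\<lambda>t. LINT s:I|lebesgue. f (min t s) * g (max t s) / w * \<sigma> s)"
    if "\<sigma> absolutely_integrable_on I" for \<sigma>
    using green_kernel_solves[OF f g w that] X by blast+
  ultimately show "is_green X a l (\<lambda>t s. f (min t s) * g (max t s) / w)"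
    by (simp add: is_green_def)
qed

text \<open>
  Uniqueness for the initial value problem, in explicit form: the coefficients are the constant
  Wronskians of \<open>u\<close> with \<open>\<theta>\<close> and \<open>\<phi>\<close>.
\<close>

lemma system_eq_combination:
  assumes "system l u z" "system l \<phi> z\<phi>" "\<phi> 0 = 1" "z\<phi> 0 = 0" "system l \<theta> z\<theta>" "\<theta> 0 = 0" "z\<theta> 0 = 1" "t \<in> I"
  shows "u t = u 0 * \<phi> t + z 0 * \<theta> t"
proof -
  have 1: "\<phi> t * z\<theta> t - \<theta> t * z\<phi> t = 1"
    using system_wronskian[OF assms(2,5,8)] assms by simp
  have 2: "u t * z\<theta> t - \<theta> t * z t = u 0"
    using system_wronskian[OF assms(1,5,8)] assms by simp
  have 3: "\<phi> t * z t - u t * z\<phi> t = z 0"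
    using system_wronskian[OF assms(2,1,8)] assms by simp
  have "u t = u t * (\<phi> t * z\<theta> t - \<theta> t * z\<phi> t)" using 1 by simp
  also have "\<dots> = (u t * z\<theta> t - \<theta> t * z t) * \<phi> t + (\<phi> t * z t - u t * z\<phi> t) * \<theta> t"
    by (simp add: algebra_simps)
  finally show ?thesis unfolding 2 3 .
qed

end

section \<open>Positivity below the first mixed eigenvalue\<close>

context potential
begin

lemma system_interior:
  assumes "system l u z" "0 < t" "t < 1"
  shows "(u has_real_derivative z t - A t * u t) (at t)"
    "(z has_real_derivative A t * z t - ((A t)\<^sup>2 + l) * u t) (at t)"
  using assms at_within_Icc_at[of 0 t 1] by (auto simp: system_def dest!: bspec[of _ _ t])

text \<open>
  With the integrating factor \<open>E = exp (\<integral>A)\<close> the system reads \<open>(E \<phi>)' = E z\<close> and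
  \<open>(z / E)' = - (A\<^sup>2 + l) \<phi> / E\<close>. Up to a first zero of \<open>\<phi>\<close> both right-hand sides are nonnegative, so
  \<open>E \<phi>\<close> does not decrease and there is no zero.
\<close>

lemma system_positive_very_negative:
  assumes sys: "system l \<phi> z" and init: "\<phi> 0 = 1" "z 0 = 0"
    and l: "\<And>t. t \<in> I \<Longrightarrow> (A t)\<^sup>2 + l \<le> 0" and t: "t \<in> I"
  shows "\<phi> t > 0"
proof (rule ccontr)
  assume "\<not> \<phi> t > 0"
  define S where "S = {s \<in> I. \<phi> s \<le> 0}"
  have "closed S"
    unfolding S_def using system_cont(1)[OF sys]
    by (intro continuous_on_closed_Collect_le continuous_on_const) auto
  moreover have "bounded S" by (rule bounded_subset[of I]) (auto simp: S_def)
  ultimately have "compact S" by (simp add: compact_eq_bounded_closed)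
  moreover have "S \<noteq> {}" using t \<open>\<not> \<phi> t > 0\<close> by (auto simp: S_def)
  ultimately obtain c where c: "c \<in> S" "\<And>s. s \<in> S \<Longrightarrow> c \<le> s"
    using compact_attains_inf[of S] by blast
  have cI: "0 \<le> c" "c \<le> 1" "\<phi> c \<le> 0" using c(1) by (auto simp: S_def)
  have pos: "\<phi> s > 0" if "0 \<le> s" "s < c" for s
    using c(2)[of s] that cI by (force simp: S_def)
  define E where "E s = exp (integral {0..s} A)" for s
  have E: "(E has_real_derivative A s * E s) (at s within I)" if "s \<in> I" for s
  proof -
    have "((\<lambda>s. integral {0..s} A) has_real_derivative A s) (at s within I)"
      by (rule indefinite_integral_has_real_derivative[OF A_cont, of _ 0]) (use that in auto)
    from DERIV_chain'[OF this DERIV_exp] show ?thesis by (simp add: E_def[abs_def] mult.commute)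
  qed
  have E_int: "(E has_real_derivative A s * E s) (at s)" if "0 < s" "s < c" for s
    using E[of s] that cI at_within_Icc_at[of 0 s 1] by auto
  have E_pos: "E s > 0" for s by (simp add: E_def)
  have E_cont: "continuous_on I E" using E by (meson DERIV_continuous continuous_on_eq_continuous_within)
  have sub: "{0..s} \<subseteq> I" if "s \<le> c" for s using that cI by auto
  have z_nonneg: "z s \<ge> 0" if s: "0 \<le> s" "s \<le> c" for s
  proof -
    have "z 0 / E 0 \<le> z s / E s"
    proof (rule DERIV_nonneg_imp_increasing_open[OF s(1), of "\<lambda>s. z s / E s"])
      fix x assume x: "0 < x" "x < s"
      then have x': "0 < x" "x < c" "x < 1" using s cI by auto
      have "((\<lambda>s. z s / E s) has_real_derivative - ((A x)\<^sup>2 + l) * \<phi> x / E x) (at x)"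
        by (rule DERIV_cong[OF DERIV_divide[OF system_interior(2)[OF sys x'(1,3)] E_int[OF x'(1,2)]]])
          (use E_pos[of x] in \<open>auto simp: field_simps\<close>)
      moreover have "- ((A x)\<^sup>2 + l) * \<phi> x / E x \<ge> 0"
        using pos[of x] x' l[of x] E_pos[of x] by (intro divide_nonneg_pos mult_nonneg_nonneg) auto
      ultimately show "\<exists>y. ((\<lambda>s. z s / E s) has_real_derivative y) (at x) \<and> y \<ge> 0" by blast
    next
      show "continuous_on {0..s} (\<lambda>s. z s / E s)"
        using E_pos sub[OF s(2)]
        by (intro continuous_on_divide continuous_on_subset[OF system_cont(2)[OF sys]] continuous_on_subset[OF E_cont])
          (auto simp: less_imp_neq[symmetric])
    qed
    then show ?thesis using E_pos[of s] by (simp add: init zero_le_divide_iff)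
  qed
  have "E 0 * \<phi> 0 \<le> E c * \<phi> c"
  proof (rule DERIV_nonneg_imp_increasing_open[OF cI(1), of "\<lambda>s. E s * \<phi> s"])
    fix x assume x: "0 < x" "x < c"
    have "((\<lambda>s. E s * \<phi> s) has_real_derivative E x * z x) (at x)"
      by (rule DERIV_cong[OF DERIV_mult'[OF E_int[OF x] system_interior(1)[OF sys x(1)]]])
        (use x cI in \<open>auto simp: algebra_simps\<close>)
    moreover have "E x * z x \<ge> 0" using z_nonneg[of x] x E_pos[of x] by (simp add: less_imp_le)
    ultimately show "\<exists>y. ((\<lambda>s. E s * \<phi> s) has_real_derivative y) (at x) \<and> y \<ge> 0" by blast
  next
    show "continuous_on {0..c} (\<lambda>s. E s * \<phi> s)"
      by (intro continuous_on_mult continuous_on_subset[OF system_cont(1)[OF sys]] continuous_on_subset[OF E_cont] sub order_refl)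
  qed
  then have "0 < E c * \<phi> c" using E_pos[of 0] init by simp
  then show False using cI(3) E_pos[of c] by (simp add: zero_less_mult_iff)
qed

lemma system_eigenvalue_M1:
  assumes sys: "system l \<phi> z" and init: "\<phi> 0 = 1" "z 0 = 0" and "\<phi> 1 = 0"
  shows "is_eigenvalue X_M1 a l"
proof -
  have "DI \<phi> 0 = 0" using system_solution(3)[OF sys, of 0] init by simp
  then have "\<phi> \<in> X_M1" using system_solution(1)[OF sys] \<open>\<phi> 1 = 0\<close> by (simp add: X_M1_def)
  then show ?thesis
    unfolding is_eigenvalue_def using system_solution(2)[OF sys] init
    by (intro bexI[of _ \<phi>] conjI bexI[of _ 0]) auto
qed

text \<open>
  Continuation in the parameter \<open>\<mu>\<close> from very negative values up to \<open>l\<close>. The set of pairs \<open>(t, \<mu>)\<close> with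
  \<open>U t \<mu> \<le> 0\<close> is compact by joint continuity, so if it is nonempty there is a smallest \<open>\<mu>\<close>. There \<open>U\<close> is
  nonnegative with a zero; an interior zero would be a minimum, with \<open>U\<close> and \<open>Z\<close> both zero, against the
  Wronskian with a second solution. The zero at \<open>1\<close> makes \<open>\<mu> \<le> l\<close> an eigenvalue.
\<close>

lemma system_positive:
  assumes sys: "system l \<phi> z" and init: "\<phi> 0 = 1" "z 0 = 0"
    and l: "\<And>\<mu>. is_eigenvalue X_M1 a \<mu> \<Longrightarrow> l < \<mu>" and t: "t \<in> I"
  shows "\<phi> t > 0"
proof (rule ccontr)
  assume neg: "\<not> \<phi> t > 0"
  have "bounded (A ` I)" using A_cont by (intro compact_imp_bounded compact_continuous_image) auto
  then obtain C where C: "\<And>t. t \<in> I \<Longrightarrow> \<bar>A t\<bar> \<le> C"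
    unfolding bounded_iff by (metis imageI real_norm_def)
  \<comment> \<open>A starting value at which \<open>system_positive_very_negative\<close> applies.\<close>
  define c where "c = min l (- C\<^sup>2)"
  have c: "(A t)\<^sup>2 + c \<le> 0" if "t \<in> I" for t
  proof -
    have "(A t)\<^sup>2 \<le> C\<^sup>2" using C[OF that] by (metis abs_ge_zero power2_abs power_mono)
    then show ?thesis by (simp add: c_def min_def)
  qed
  obtain U Z where U: "continuous_on (I \<times> {c..l}) (\<lambda>(t, \<mu>). U t \<mu> :: real)"
    and UZ: "\<And>\<mu>. \<mu> \<in> {c..l} \<Longrightarrow> system \<mu> (\<lambda>t. U t \<mu>) (\<lambda>t. Z t \<mu>)"
    and U0: "\<And>\<mu>. \<mu> \<in> {c..l} \<Longrightarrow> U 0 \<mu> = 1" and Z0: "\<And>\<mu>. \<mu> \<in> {c..l} \<Longrightarrow> Z 0 \<mu> = 0"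
    by (rule system_exists_param[of c l 1 0]) blast
  have cl: "c \<le> l" by (simp add: c_def)
  define S where "S = {p \<in> I \<times> {c..l}. (\<lambda>(t, \<mu>). U t \<mu>) p \<le> 0}"
  have K: "compact (I \<times> {c..l})" by (intro compact_Times compact_Icc)
  then have "closed S"
    unfolding S_def using U
    by (intro continuous_on_closed_Collect_le continuous_on_const compact_imp_closed) auto
  moreover have "bounded S"
    using compact_imp_bounded[OF K] by (rule bounded_subset) (auto simp: S_def)
  ultimately have "compact S" by (simp add: compact_eq_bounded_closed)
  have "(t, l) \<in> S"
  proof -
    have "system l (\<lambda>t. U t l) (\<lambda>t. Z t l)" "U 0 l = 1" "Z 0 l = 0" using UZ U0 Z0 cl by auto
    moreover obtain \<theta> z\<theta> where "system l \<theta> z\<theta>" "\<theta> 0 = 0" "z\<theta> 0 = 1" by (rule system_exists)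
    ultimately have "\<phi> t = U t l"
      using system_eq_combination[OF sys, of "\<lambda>t. U t l" "\<lambda>t. Z t l" \<theta> z\<theta> t] t init by simp
    then show ?thesis using neg t cl by (simp add: S_def)
  qed
  then have "S \<noteq> {}" by blast
  then obtain p where p: "p \<in> S" "\<And>q. q \<in> S \<Longrightarrow> snd p \<le> snd q"
    using continuous_attains_inf[OF \<open>compact S\<close> _ continuous_on_snd[OF continuous_on_id]] by blast
  obtain t0 \<mu> where p_eq: "p = (t0, \<mu>)" by (cases p)
  have t0: "t0 \<in> I" and \<mu>: "\<mu> \<in> {c..l}" and U_t0: "U t0 \<mu> \<le> 0"
    using p(1) by (auto simp: S_def p_eq)
  have before: "U s \<nu> > 0" if "s \<in> I" "\<nu> \<in> {c..<\<mu>}" for s \<nu>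
    using p(2)[of "(s, \<nu>)"] that \<mu> by (force simp: S_def p_eq)
  have "c \<noteq> \<mu>"
    using system_positive_very_negative[OF UZ[of c] U0 Z0 c t0] cl U_t0 by auto
  then have "c < \<mu>" using \<mu> by auto
  have nonneg: "U s \<mu> \<ge> 0" if s: "s \<in> I" for s
  proof -
    have "continuous_on {c..l} (\<lambda>\<nu>. U s \<nu>)"
    proof -
      have "continuous_on {c..l} (\<lambda>\<nu>. (s, \<nu>))" by (intro continuous_on_Pair continuous_on_const continuous_on_id)
      moreover have "(\<lambda>\<nu>. (s, \<nu>)) ` {c..l} \<subseteq> I \<times> {c..l}" using s by auto
      ultimately show ?thesis using continuous_on_compose2[OF U, of "{c..l}" "\<lambda>\<nu>. (s, \<nu>)"] by auto
    qed
    then have "continuous_on {c..\<mu>} (\<lambda>\<nu>. U s \<nu>)" by (rule continuous_on_subset) (use \<mu> in auto)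
    then have "((\<lambda>\<nu>. U s \<nu>) \<longlongrightarrow> U s \<mu>) (at_left \<mu>)" using \<open>c < \<mu>\<close> by (rule continuous_on_Icc_at_leftD)
    moreover have "\<forall>\<^sub>F \<nu> in at_left \<mu>. U s \<nu> \<ge> 0"
      using before[OF s] \<open>c < \<mu>\<close> by (auto simp: eventually_at_left[OF \<open>c < \<mu>\<close>] intro!: exI[of _ c] less_imp_le)
    ultimately show ?thesis by (rule tendsto_lowerbound) simp
  qed
  have zero: "U t0 \<mu> = 0" using nonneg[OF t0] U_t0 by simp
  have "t0 \<noteq> 0" using U0[OF \<mu>] zero by auto
  have "t0 = 1"
  proof (rule ccontr)
    assume "t0 \<noteq> 1"
    then have t0': "0 < t0" "t0 < 1" using t0 \<open>t0 \<noteq> 0\<close> by auto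
    have "Z t0 \<mu> - A t0 * U t0 \<mu> = 0"
    proof (rule DERIV_local_min[OF system_interior(1)[OF UZ[OF \<mu>] t0']])
      show "0 < min t0 (1 - t0)" using t0' by simp
      show "\<forall>y. \<bar>t0 - y\<bar> < min t0 (1 - t0) \<longrightarrow> U t0 \<mu> \<le> U y \<mu>"
      proof (intro allI impI)
        fix y assume "\<bar>t0 - y\<bar> < min t0 (1 - t0)"
        then have "y \<in> I" by (auto simp: abs_less_iff)
        then show "U t0 \<mu> \<le> U y \<mu>" using nonneg zero by simp
      qed
    qed
    then have "Z t0 \<mu> = 0" using zero by simp
    moreover obtain \<theta> z\<theta> where "system \<mu> \<theta> z\<theta>" "\<theta> 0 = 0" "z\<theta> 0 = 1" by (rule system_exists)
    ultimately show False
      using system_wronskian[OF UZ[OF \<mu>] _ t0, of \<theta> z\<theta>] zero U0[OF \<mu>] by simp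
  qed
  then have "is_eigenvalue X_M1 a \<mu>"
    using system_eigenvalue_M1[OF UZ[OF \<mu>] U0[OF \<mu>] Z0[OF \<mu>]] zero by simp
  then show False using l \<mu> by fastforce
qed

end

section \<open>Comparison of the two Green functions\<close>

theorem corollary3p18:
  fixes a :: "real \<Rightarrow> real" and l l0 :: real
  assumes "a absolutely_integrable_on I"
    and "is_first_eigenvalue X_M1 a l0"
    and "l < l0"
  shows "\<forall>t\<in>{0<..<1}. \<forall>s\<in>{0<..<1}.
           green X_M1 a l t s < green X_D a l t s \<and> green X_D a l t s < 0"
proof -
  interpret potential a by unfold_locales (rule assms(1))
  have below: "l < \<mu>" if "is_eigenvalue X_M1 a \<mu>" for \<mu>
    using assms(2,3) that by (force simp: is_first_eigenvalue_def)
  obtain \<phi> z\<phi> where \<phi>: "system l \<phi> z\<phi>" "\<phi> 0 = 1" "z\<phi> 0 = 0" by (rule system_exists)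
  obtain \<theta> z\<theta> where \<theta>: "system l \<theta> z\<theta>" "\<theta> 0 = 0" "z\<theta> 0 = 1" by (rule system_exists)
  have \<phi>_pos: "\<phi> t > 0" if "t \<in> I" for t
    using system_positive[OF \<phi> below that] .
  have wronskian: "\<phi> t * z\<theta> t - \<theta> t * z\<phi> t = 1" if "t \<in> I" for t
    using system_wronskian[OF \<phi>(1) \<theta>(1) that] \<phi> \<theta> by simp
  \<comment> \<open>The derivative of \<open>\<theta> / \<phi>\<close> is the Wronskian, which is \<open>1\<close>, divided by \<open>\<phi>\<^sup>2\<close>.\<close>
  have ratio: "\<theta> x / \<phi> x < \<theta> y / \<phi> y" if "0 \<le> x" "x < y" "y \<le> 1" for x y
  proof (rule DERIV_pos_imp_increasing_open[OF that(2), of "\<lambda>t. \<theta> t / \<phi> t"])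
    fix t assume t: "x < t" "t < y"
    then have t': "0 < t" "t < 1" "t \<in> I" using that by auto
    have "((\<lambda>t. \<theta> t / \<phi> t) has_real_derivative 1 / (\<phi> t * \<phi> t)) (at t)"
    proof (rule DERIV_cong[OF DERIV_divide[OF system_interior(1)[OF \<theta>(1) t'(1,2)] system_interior(1)[OF \<phi>(1) t'(1,2)]]])
      show "\<phi> t \<noteq> 0" using \<phi>_pos[OF t'(3)] by simp
      show "((z\<theta> t - A t * \<theta> t) * \<phi> t - \<theta> t * (z\<phi> t - A t * \<phi> t)) / (\<phi> t * \<phi> t) = 1 / (\<phi> t * \<phi> t)"
        using wronskian[OF t'(3)] by (simp add: algebra_simps)
    qed
    then show "\<exists>d. ((\<lambda>t. \<theta> t / \<phi> t) has_real_derivative d) (at t) \<and> d > 0"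
      using \<phi>_pos[OF t'(3)] by (intro exI[of _ "1 / (\<phi> t * \<phi> t)"]) auto
  next
    have "{x..y} \<subseteq> I" using that by auto
    then show "continuous_on {x..y} (\<lambda>t. \<theta> t / \<phi> t)"
      using \<phi>_pos
      by (intro continuous_on_divide continuous_on_subset[OF system_cont(1)[OF \<theta>(1)]]
          continuous_on_subset[OF system_cont(1)[OF \<phi>(1)]]) (auto simp: less_imp_neq[symmetric] subset_iff)
  qed
  have \<theta>_pos: "\<theta> t > 0" if "0 < t" "t \<le> 1" for t
    using ratio[of 0 t] \<theta>(2) \<phi>_pos[of t] that by (simp add: zero_less_divide_iff)
  define \<psi> z\<psi> where "\<psi> t = \<theta> 1 * \<phi> t + (- \<phi> 1) * \<theta> t" and "z\<psi> t = \<theta> 1 * z\<phi> t + (- \<phi> 1) * z\<theta> t" for t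
  have \<psi>: "system l \<psi> z\<psi>"
    unfolding \<psi>_def[abs_def] z\<psi>_def[abs_def] by (rule system_linear[OF \<phi>(1) \<theta>(1)])
  have \<psi>_1: "\<psi> 1 = 0" by (simp add: \<psi>_def)
  have \<psi>_pos: "\<psi> t > 0" if "0 \<le> t" "t < 1" for t
  proof -
    have "\<theta> t / \<phi> t < \<theta> 1 / \<phi> 1" using ratio that by simp
    then show ?thesis
      using \<phi>_pos[of t] \<phi>_pos[of 1] that by (simp add: \<psi>_def field_simps)
  qed
  have \<phi>1: "\<phi> 1 > 0" and \<theta>1: "\<theta> 1 > 0" using \<phi>_pos \<theta>_pos by auto
  have diff: "u t - v t = (u 0 - v 0) * \<phi> t + (quasi u 0 - quasi v 0) * \<theta> t"
    if "u \<in> W21" "v \<in> W21" "solves a l \<sigma> u" "solves a l \<sigma> v" "t \<in> I" for u v \<sigma> t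
    using system_eq_combination[OF solutions_diff_system[OF that(1,3,2,4)] \<phi> \<theta> that(5)] .
  have green_M1: "green X_M1 a l t s = \<phi> (min t s) * \<psi> (max t s) / - \<phi> 1" if "t \<in> I" "s \<in> I" for t s
  proof (rule green_kernel[OF \<phi>(1) \<psi> _ _ _ _ that])
    show "- \<phi> 1 = \<phi> 0 * z\<psi> 0 - \<psi> 0 * z\<phi> 0" using \<phi> \<theta> by (simp add: z\<psi>_def)
    show "- \<phi> 1 \<noteq> 0" using \<phi>1 by simp
    show "u \<in> X_M1" if "u \<in> W21" "DI u 0 = z\<phi> 0 * c" "u 1 = \<psi> 1 * d" for u c d
      using that \<phi>(3) \<psi>_1 by (simp add: X_M1_def)
    show "\<forall>t\<in>I. u t = v t" if uv: "u \<in> X_M1" "v \<in> X_M1" "solves a l \<sigma> u" "solves a l \<sigma> v" for u v \<sigma>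
    proof -
      have "u t - v t = (u 0 - v 0) * \<phi> t" if "t \<in> I" for t
        using diff[of u v \<sigma> t] uv that by (simp add: X_M1_def quasi_def)
      moreover from this[of 1] have "u 0 - v 0 = 0" using uv \<phi>1 by (simp add: X_M1_def)
      ultimately show ?thesis by simp
    qed
  qed
  have green_D: "green X_D a l t s = \<theta> (min t s) * \<psi> (max t s) / - \<theta> 1" if "t \<in> I" "s \<in> I" for t s
  proof (rule green_kernel[OF \<theta>(1) \<psi> _ _ _ _ that])
    show "- \<theta> 1 = \<theta> 0 * z\<psi> 0 - \<psi> 0 * z\<theta> 0" using \<phi> \<theta> by (simp add: \<psi>_def)
    show "- \<theta> 1 \<noteq> 0" using \<theta>1 by simp
    show "u \<in> X_D" if "u \<in> W21" "u 0 = \<theta> 0 * c" "u 1 = \<psi> 1 * d" for u c d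
      using that \<theta>(2) \<psi>_1 by (simp add: X_D_def)
    show "\<forall>t\<in>I. u t = v t" if uv: "u \<in> X_D" "v \<in> X_D" "solves a l \<sigma> u" "solves a l \<sigma> v" for u v \<sigma>
    proof -
      have "u t - v t = (quasi u 0 - quasi v 0) * \<theta> t" if "t \<in> I" for t
        using diff[of u v \<sigma> t] uv that by (simp add: X_D_def)
      moreover from this[of 1] have "quasi u 0 - quasi v 0 = 0" using uv \<theta>1 by (simp add: X_D_def)
      ultimately show ?thesis by simp
    qed
  qed
  show ?thesis
  proof (intro ballI conjI)
    fix t s :: real assume ts: "t \<in> {0<..<1}" "s \<in> {0<..<1}"
    define m M where "m = min t s" and "M = max t s"
    have mM: "0 < m" "m < 1" "0 < M" "M < 1" using ts by (auto simp: m_def M_def)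
    have D: "green X_D a l t s = - (\<theta> m * \<psi> M / \<theta> 1)" and M1: "green X_M1 a l t s = - (\<phi> m * \<psi> M / \<phi> 1)"
      using green_D[of t s] green_M1[of t s] ts by (simp_all add: m_def M_def)
    show "green X_D a l t s < 0"
      unfolding D using \<theta>_pos[of m] \<psi>_pos[of M] \<theta>1 mM by simp
    have "\<phi> m * \<psi> M / \<phi> 1 - \<theta> m * \<psi> M / \<theta> 1 = \<psi> m * \<psi> M / (\<phi> 1 * \<theta> 1)"
      using \<phi>1 \<theta>1 by (simp add: \<psi>_def field_simps)
    moreover have "\<psi> m * \<psi> M / (\<phi> 1 * \<theta> 1) > 0"
      using \<psi>_pos[of m] \<psi>_pos[of M] \<phi>1 \<theta>1 mM by simp
    ultimately show "green X_M1 a l t s < green X_D a l t s" unfolding D M1 by linarith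
  qed
qed

end
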